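(* For each integer $n\ge 2$ there exist a nondegenerate tetrahedron $T_0\subset\mathbb R^3$ and an infinite nested sequence $T_0\supset T_1\supset T_2\supset\cdots$ of tetrahedra such that for every $k\ge 0$ there is a longest edge $e_k$ of $T_k$ with $T_{k+1}\in\mathcal N_n(T_k,e_k)$ (i.e. $T_{k+1}$ is one of the $n$ children of $T_k$ under longest-edge $n$-section along $e_k$), and such that the sequence $(T_k)_{k\ge0}$ fails shape regularity and fails both angle conditions, that is: (i) there is no constant $C$ with $h_{T_k}/r_{T_k}\le C$ for all $k$; (ii) there is no constant $\alpha_0>0$ such that $\theta\ge\alpha_0$ for all $k$ and all $\theta\in\mathcal A(T_k)$; (iii) there is no constant $\alpha_1<\pi$ such that $\theta\le\alpha_1$ for all $k$ and all $\theta\in\mathcal A(T_k)$. Moreover, if $n\ge3$, then for every $k\ge0$ the edge $e_k$ is the unique longest edge of $T_k$. If $n=2$, then for infinitely many $k$ two distinct edges of $T_k$ are both longest edges of $T_k$ (they have equal length $h_{T_k}$).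
   Context: A tetrahedron is the convex hull of four affinely independent points of $\mathbb R^3$ (closed, nondegenerate). For a tetrahedron $T$: $h_T=\operatorname{diam}T$ is the length of its longest edge; a longest edge is an edge of length $h_T$; $r_T$ is the inradius; $\mathcal A(T)$ is the set consisting of the twelve planar angles of the four triangular faces of $T$ together with the six interior dihedral angles of $T$. Edge $n$-section: for an integer $n\ge2$, a tetrahedron $T=\operatorname{conv}\{A,B,C,D\}$ and its edge $e=AB$, put $P_j=(1-j/n)A+(j/n)B$ for $0\le j\le n$ and $$\mathcal N_n(T,e)=\bigl\{\operatorname{conv}\{P_{j-1},P_j,C,D\}:1\le j\le n\bigr\},$$ the set of the $n$ children of $T$. A longest-edge $n$-section of $T$ is this operation with $e$ a longest edge of $T$ (any longest edge may be chosen if there are several). *)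

theory Defs
  imports "HOL-Analysis.Analysis"
begin

definition tetrahedron :: "(real^3) set \<Rightarrow> bool" where
  "tetrahedron T \<longleftrightarrow> 3 simplex T"

definition longest_edge :: "(real^3) set \<Rightarrow> (real^3) set \<Rightarrow> bool" where
  "longest_edge T e \<longleftrightarrow>
     e edge_of T \<and> (\<exists>A B. e = closed_segment A B \<and> dist A B = diameter T)"

definition inradius :: "(real^3) set \<Rightarrow> real" where
  "inradius T = Sup {r. 0 \<le> r \<and> (\<exists>c. cball c r \<subseteq> T)}"

definition vec_angle :: "real^3 \<Rightarrow> real^3 \<Rightarrow> real" where
  "vec_angle u v = arccos (u \<bullet> v / (norm u * norm v))"

definition planar_angle :: "real^3 \<Rightarrow> real^3 \<Rightarrow> real^3 \<Rightarrow> real" where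
  "planar_angle P Q R = vec_angle (Q - P) (R - P)"

definition orth_part :: "real^3 \<Rightarrow> real^3 \<Rightarrow> real^3" where
  "orth_part d v = v - ((v \<bullet> d) / (d \<bullet> d)) *\<^sub>R d"

text \<open>The interior dihedral angle along \<open>PQ\<close> between the faces \<open>PQR\<close> and \<open>PQS\<close> is the
  angle between the components of \<open>R - P\<close> and \<open>S - P\<close> orthogonal to \<open>PQ\<close>, each of which
  is perpendicular to \<open>PQ\<close> and points into its face.\<close>

definition dihedral_angle :: "real^3 \<Rightarrow> real^3 \<Rightarrow> real^3 \<Rightarrow> real^3 \<Rightarrow> real" where
  "dihedral_angle P Q R S = vec_angle (orth_part (Q - P) (R - P)) (orth_part (Q - P) (S - P))"

definition vertices :: "(real^3) set \<Rightarrow> (real^3) set" where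
  "vertices T = {x. x extreme_point_of T}"

definition angles :: "(real^3) set \<Rightarrow> real set" where
  "angles T =
     {planar_angle P Q R | P Q R. {P, Q, R} \<subseteq> vertices T \<and> distinct [P, Q, R]} \<union>
     {dihedral_angle P Q R S | P Q R S. {P, Q, R, S} \<subseteq> vertices T \<and> distinct [P, Q, R, S]}"

text \<open>If \<open>T\<close> is a tetrahedron and \<open>e\<close> one of its edges, a labelling as below exists, and it is
  unique up to exchanging \<open>A\<close> with \<open>B\<close> and \<open>C\<close> with \<open>D\<close>. Neither exchange changes the set
  of children: the first replaces \<open>j\<close> by \<open>n + 1 - j\<close>.\<close>

definition children :: "nat \<Rightarrow> (real^3) set \<Rightarrow> (real^3) set \<Rightarrow> (real^3) set set" where
  "children n T e =
     {convex hull {P (j - 1), P j, C, D} | P A B C D j.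
        T = convex hull {A, B, C, D} \<and> e = closed_segment A B \<and>
        P = (\<lambda>i. (1 - real i / real n) *\<^sub>R A + (real i / real n) *\<^sub>R B) \<and>
        1 \<le> j \<and> j \<le> n}"

end

theory Submission
  imports Defs
begin

text \<open>
  The tetrahedra flatten because one period of the process, two sections, acts on them in an
  unbalanced way. Let \<open>p\<^sub>0, p\<^sub>1, \<dots>\<close> be points of the plane \<open>z = 0\<close> and let the tetrahedron at the start
  of period \<open>k\<close> have the base \<open>p\<^sub>k p\<^bsub>k+1\<^esub> p\<^bsub>k+2\<^esub>\<close> and an apex at height \<open>\<zeta>\<^sub>k\<close> above this plane. One of the
  two sections cuts an edge of the base and produces \<open>p\<^bsub>k+3\<^esub>\<close>; the other one cuts the edge from a base
  vertex to the apex, which divides the height by \<open>n\<close>. The area of the base is also divided by \<open>n\<close>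
  only. So height and area keep a constant ratio, and the height divided by a length of order
  area over diameter is a constant times the diameter, which tends to \<open>0\<close>. Such a thin tetrahedron
  has a small inradius and a small dihedral angle at a base edge, and an angle close to \<open>\<pi>\<close> appears
  where a vertex comes close to the inside of an edge or face
  (\<open>diameter_inradius_unbounded\<close>, \<open>dihedral_angle_tendsto_0\<close>, \<open>dihedral_angle_tendsto_pi\<close>,
  \<open>planar_angle_tendsto_pi\<close>).

  It remains to make the two edges that are cut the longest ones.

  For \<open>n \<ge> 3\<close> the cuts are made near \<open>p\<^bsub>k+1\<^esub>\<close>, first on \<open>p\<^bsub>k+1\<^esub> p\<^sub>k\<close> and then on the edge from
  \<open>p\<^bsub>k+1\<^esub>\<close> to the apex, so that \<open>p\<^bsub>k+3\<^esub> = p\<^bsub>k+1\<^esub> + (p\<^sub>k - p\<^bsub>k+1\<^esub>) / n\<close>. The apex stays above the point of the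
  base with barycentric weights \<open>n, 1, n\<close> over \<open>2 n + 1\<close>, because this choice is compatible with the
  recurrence. Up to signs the edge vectors \<open>y\<^sub>k\<close> of the polygon satisfy \<open>y\<^bsub>k+2\<^esub> = y\<^bsub>k+1\<^esub> - y\<^sub>k / n\<close>. The
  roots of \<open>t\<^sup>2 - t + 1 / n\<close> are complex for \<open>n = 3\<close>, equal for \<open>n = 4\<close> and real for \<open>n \<ge> 5\<close>, but in
  each case there is an orbit on which a few homogeneous inequalities (\<open>needle_cone\<close>) persist, and
  these imply all comparisons of lengths, strictly (\<open>lifted_triangle_lengths\<close>).

  For \<open>n = 2\<close> the base triangles are similar, with sides in the ratio \<open>1 : 1 : 1 / \<surd>2\<close>, and the apex
  stands vertically above the base vertex \<open>p\<^bsub>k+2\<^esub>\<close>. The edge from \<open>p\<^sub>k\<close> to the apex is the longest by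
  Pythagoras. Once it is halved, both legs \<open>p\<^sub>k p\<^bsub>k+1\<^esub>\<close> and \<open>p\<^sub>k p\<^bsub>k+2\<^esub>\<close> of the base are longest edges;
  halving \<open>p\<^sub>k p\<^bsub>k+2\<^esub>\<close> and dropping \<open>p\<^sub>k\<close> gives \<open>p\<^bsub>k+3\<^esub>\<close>, with the midpoint of the other edge
  vertically above it.
\<close>

section \<open>Tetrahedra spanned by four points\<close>

text \<open>Six times the signed volume. Its being nonzero is the form in which nondegeneracy is used,
  since it can be computed along the recurrences.\<close>

definition triple :: "real^3 \<Rightarrow> real^3 \<Rightarrow> real^3 \<Rightarrow> real^3 \<Rightarrow> real" where
  "triple A B C D = cross3 (B - A) (C - A) \<bullet> (D - A)"

lemma triple_nonzero_distinct:
  assumes "triple A B C D \<noteq> 0"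
  shows "distinct [A, B, C, D]"
proof -
  have "A \<noteq> B \<and> A \<noteq> C \<and> A \<noteq> D \<and> B \<noteq> C \<and> B \<noteq> D \<and> C \<noteq> D"
    using assms by (auto simp: triple_def dot_cross_self)
  then show ?thesis by simp
qed

text \<open>The inner product of an affine relation with the cross product of two edge vectors
  isolates the coefficient that belongs to the third edge vector.\<close>

lemma triple_nonzero_independent:
  assumes "triple A B C D \<noteq> 0"
  shows "\<not> affine_dependent {A, B, C, D}"
proof
  assume "affine_dependent {A, B, C, D}"
  then obtain u where u: "sum u {A, B, C, D} = 0" "\<exists>v\<in>{A, B, C, D}. u v \<noteq> 0"
      "(\<Sum>v\<in>{A, B, C, D}. u v *\<^sub>R v) = 0"
    by (auto simp: affine_dependent_explicit_finite)
  have d: "distinct [A, B, C, D]"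
    using assms by (rule triple_nonzero_distinct)
  have s: "u A = - u B - u C - u D"
    using u(1) d by simp
  let ?x = "B - A" and ?y = "C - A" and ?z = "D - A"
  have "u A *\<^sub>R A + u B *\<^sub>R B + u C *\<^sub>R C + u D *\<^sub>R D = 0"
    using u(3) d by (simp add: add.assoc)
  then have e: "u B *\<^sub>R ?x + u C *\<^sub>R ?y + u D *\<^sub>R ?z = 0"
    unfolding s by (simp add: algebra_simps)
  have "cross3 ?x ?y \<bullet> (u B *\<^sub>R ?x + u C *\<^sub>R ?y + u D *\<^sub>R ?z) = u D * triple A B C D"
    by (simp add: inner_add_right dot_cross_self triple_def)
  then have "u D = 0" using e assms by simp
  moreover have "cross3 ?y ?z \<bullet> (u B *\<^sub>R ?x + u C *\<^sub>R ?y + u D *\<^sub>R ?z) = u B * triple A B C D"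
    using cross_triple[of ?x ?y ?z] by (simp add: inner_add_right dot_cross_self triple_def)
  then have "u B = 0" using e assms by simp
  moreover have "cross3 ?z ?x \<bullet> (u B *\<^sub>R ?x + u C *\<^sub>R ?y + u D *\<^sub>R ?z) = u C * triple A B C D"
    using cross_triple[of ?z ?x ?y] by (simp add: inner_add_right dot_cross_self triple_def)
  then have "u C = 0" using e assms by simp
  ultimately show False using u(2) s by auto
qed

lemma tetrahedron_hull:
  assumes "triple A B C D \<noteq> 0"
  shows "tetrahedron (convex hull {A, B, C, D})"
  unfolding tetrahedron_def simplex_def
  using triple_nonzero_independent[OF assms] triple_nonzero_distinct[OF assms]
  by (intro exI[of _ "{A, B, C, D}"]) simp

lemma vertices_hull:
  assumes "triple A B C D \<noteq> 0"
  shows "vertices (convex hull {A, B, C, D}) = {A, B, C, D}"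
  unfolding vertices_def
    extreme_point_of_convex_hull_affine_independent[OF triple_nonzero_independent[OF assms]]
  by (rule Collect_mem_eq)

lemma diameter_hull:
  fixes S :: "(real^3) set"
  assumes "finite S" "A \<in> S" "B \<in> S" "\<And>P Q. P \<in> S \<Longrightarrow> Q \<in> S \<Longrightarrow> dist P Q \<le> dist A B"
  shows "diameter (convex hull S) = dist A B"
proof (rule antisym)
  show "diameter (convex hull S) \<le> dist A B"
  proof (rule diameter_le)
    fix x y assume "x \<in> convex hull S" "y \<in> convex hull S"
    then obtain u v where "u \<in> S" "v \<in> S" "norm (x - y) \<le> norm (u - v)"
      using simplex_extremal_le_exists[OF assms(1)] by blast
    then show "norm (x - y) \<le> dist A B" using assms(4)[of u v] by (simp add: dist_norm)
  qed simp
  have "bounded (convex hull S)"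
    using assms(1) by (simp add: finite_imp_bounded bounded_convex_hull)
  then show "dist A B \<le> diameter (convex hull S)"
    using assms(2,3) by (intro diameter_bounded_bound) (auto simp: hull_inc)
qed

lemma edge_hull:
  assumes "triple A B C D \<noteq> 0" "P \<in> {A, B, C, D}" "Q \<in> {A, B, C, D}" "P \<noteq> Q"
  shows "closed_segment P Q edge_of convex hull {A, B, C, D}"
  unfolding edge_of_def segment_convex_hull
proof
  have "{P, Q} \<subseteq> {A, B, C, D}" using assms(2,3) by simp
  then show "convex hull {P, Q} face_of convex hull {A, B, C, D}"
    unfolding face_of_convex_hull_affine_independent[OF triple_nonzero_independent[OF assms(1)]]
    by (intro exI[of _ "{P, Q}"]) simp
  show "aff_dim (convex hull {P, Q}) = 1"
    using assms(4) by (simp add: aff_dim_convex_hull aff_dim_2)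
qed

definition longest_pair :: "real^3 \<Rightarrow> real^3 \<Rightarrow> real^3 \<Rightarrow> real^3 \<Rightarrow> bool" where
  "longest_pair A B C D \<longleftrightarrow>
     (\<forall>P\<in>{A, B, C, D}. \<forall>Q\<in>{A, B, C, D}. dist P Q \<le> dist A B)"

lemma longest_pairI:
  assumes "dist A C \<le> dist A B" "dist A D \<le> dist A B" "dist B C \<le> dist A B"
    "dist B D \<le> dist A B" "dist C D \<le> dist A B"
  shows "longest_pair A B C D"
  using assms by (simp add: longest_pair_def dist_commute)

text \<open>An edge is a segment between vertices, as endpoints of a face that is a segment are extreme
  points of the whole; so longest edges can be found by comparing six distances.\<close>

lemma longest_edge_hull_iff:
  assumes "triple A B C D \<noteq> 0" "longest_pair A B C D"
  shows "longest_edge (convex hull {A, B, C, D}) e \<longleftrightarrow>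
    (\<exists>P\<in>{A, B, C, D}. \<exists>Q\<in>{A, B, C, D}. e = closed_segment P Q \<and> dist P Q = dist A B)"
    (is "longest_edge ?T e \<longleftrightarrow> ?R")
proof
  have diam: "diameter ?T = dist A B"
    by (rule diameter_hull) (use assms(2) in \<open>auto simp: longest_pair_def\<close>)
  {
    assume "longest_edge ?T e"
    then obtain P Q where e: "e face_of ?T" "e = closed_segment P Q" "dist P Q = dist A B"
      unfolding longest_edge_def edge_of_def diam by blast
    have "P extreme_point_of ?T" "Q extreme_point_of ?T"
      using extreme_point_of_face[OF e(1)] extreme_point_of_segment e(2) by blast+
    then have "P \<in> {A, B, C, D}" "Q \<in> {A, B, C, D}"
      using vertices_hull[OF assms(1)] unfolding vertices_def by blast+
    then show ?R using e by blast
  next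
    assume ?R
    then obtain P Q where PQ: "P \<in> {A, B, C, D}" "Q \<in> {A, B, C, D}"
      "e = closed_segment P Q" "dist P Q = dist A B" by blast
    have "A \<noteq> B" using triple_nonzero_distinct[OF assms(1)] by simp
    then have "P \<noteq> Q" using PQ(4) by auto
    then show "longest_edge ?T e"
      unfolding longest_edge_def diam using edge_hull[OF assms(1) PQ(1,2)] PQ(3,4) by blast
  }
qed

text \<open>Every section below keeps the child that contains an endpoint of the edge that is cut. Naming
  this endpoint \<open>A\<close>, it is the first child.\<close>

lemma first_child:
  assumes "1 \<le> n"
  shows "convex hull {A, A + (1 / real n) *\<^sub>R (B - A), C, D}
    \<in> children n (convex hull {A, B, C, D}) (closed_segment A B)"
proof -
  define P where "P = (\<lambda>i. (1 - real i / real n) *\<^sub>R A + (real i / real n) *\<^sub>R B)"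
  have "P (1 - 1) = A" "P 1 = A + (1 / real n) *\<^sub>R (B - A)"
    by (simp_all add: P_def algebra_simps)
  then have child: "convex hull {A, A + (1 / real n) *\<^sub>R (B - A), C, D} = convex hull {P (1 - 1), P 1, C, D}"
    by simp
  show ?thesis
    unfolding children_def mem_Collect_eq
    by (rule exI[of _ P], rule exI[of _ A], rule exI[of _ B], rule exI[of _ C], rule exI[of _ D],
        rule exI[of _ 1]) (use P_def assms child in simp)
qed

lemma first_child_psubset:
  assumes "2 \<le> n" "triple A B C D \<noteq> 0"
  shows "convex hull {A, A + (1 / real n) *\<^sub>R (B - A), C, D} \<subset> convex hull {A, B, C, D}"
proof -
  let ?P = "A + (1 / real n) *\<^sub>R (B - A)"
  have d: "distinct [A, B, C, D]" by (rule triple_nonzero_distinct[OF assms(2)])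
  have P: "?P = (1 - 1 / real n) *\<^sub>R A + (1 / real n) *\<^sub>R B"
    by (simp add: algebra_simps)
  have "?P \<in> closed_segment A B"
    unfolding closed_segment_def using assms(1) P by (intro CollectI exI[of _ "1 / real n"]) simp
  also have "\<dots> \<subseteq> convex hull {A, B, C, D}"
    unfolding segment_convex_hull by (rule hull_mono) simp
  finally have "convex hull {A, ?P, C, D} \<subseteq> convex hull {A, B, C, D}"
    by (intro hull_minimal) (auto simp: hull_inc)
  moreover have "convex hull {A, ?P, C, D} \<noteq> convex hull {A, B, C, D}"
  proof
    assume "convex hull {A, ?P, C, D} = convex hull {A, B, C, D}"
    moreover have "B extreme_point_of convex hull {A, B, C, D}"
      using vertices_hull[OF assms(2)] by (auto simp: vertices_def)
    ultimately have "B \<in> {A, ?P, C, D}"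
      using extreme_point_of_convex_hull by metis
    then have "B = ?P" using d by auto
    then have "(1 - 1 / real n) *\<^sub>R (B - A) = 0" by (simp add: algebra_simps)
    then show False using d assms(1) by simp
  qed
  ultimately show ?thesis by blast
qed

text \<open>Needed because a quotient by an inradius \<open>0\<close> would be \<open>0\<close> by convention. The supremum that
  defines the inradius is over a bounded set as balls in \<open>T\<close> have diameter at most that of \<open>T\<close>.\<close>

lemma inradius_pos:
  assumes "triple A B C D \<noteq> 0"
  shows "0 < inradius (convex hull {A, B, C, D})"
proof -
  let ?T = "convex hull {A, B, C, D}"
  have "interior ?T \<noteq> {}"
    using interior_convex_hull_eq_empty[of "{A, B, C, D}"] triple_nonzero_independent[OF assms]
      triple_nonzero_distinct[OF assms] by simp
  then obtain c where "c \<in> interior ?T" by blast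
  then obtain r where r: "0 < r" "cball c r \<subseteq> ?T"
    unfolding mem_interior_cball by blast
  have bdd: "bdd_above {r. 0 \<le> r \<and> (\<exists>c. cball c r \<subseteq> ?T)}"
  proof (rule bdd_aboveI)
    fix s assume "s \<in> {r. 0 \<le> r \<and> (\<exists>c. cball c r \<subseteq> ?T)}"
    then obtain c where s: "0 \<le> s" "cball c s \<subseteq> ?T" by blast
    have "bounded ?T" by (simp add: finite_imp_bounded bounded_convex_hull)
    then have "diameter (cball c s) \<le> diameter ?T" using s by (intro diameter_subset)
    then show "s \<le> diameter ?T" using s by simp
  qed
  have "r \<le> inradius ?T"
    unfolding inradius_def using r bdd by (intro cSup_upper) auto
  then show ?thesis using r by simp
qed

text \<open>A ball inside a horizontal slab contains the points vertically above and below its centre.\<close>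

lemma inradius_le_slab:
  fixes S :: "(real^3) set"
  assumes "\<And>x. x \<in> S \<Longrightarrow> 0 \<le> x $ 3 \<and> x $ 3 \<le> h" "S \<noteq> {}"
  shows "inradius (convex hull S) \<le> h / 2"
  unfolding inradius_def
proof (rule cSup_least)
  obtain x where "x \<in> S" using assms(2) by blast
  then have "cball x 0 \<subseteq> convex hull S" by (simp add: hull_inc)
  then show "{r. 0 \<le> r \<and> (\<exists>c. cball c r \<subseteq> convex hull S)} \<noteq> {}" by blast
  have "S \<subseteq> {x. 0 \<le> x $ 3} \<inter> {x. x $ 3 \<le> h}" using assms(1) by auto
  moreover have "convex ({x::real^3. 0 \<le> x $ 3} \<inter> {x. x $ 3 \<le> h})"
    using convex_halfspace_le[of "axis 3 1 :: real^3" h] convex_halfspace_ge[of 0 "axis 3 1 :: real^3"]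
    by (intro convex_Int) (simp_all add: inner_axis')
  ultimately have slab: "convex hull S \<subseteq> {x. 0 \<le> x $ 3} \<inter> {x. x $ 3 \<le> h}"
    by (rule hull_minimal)
  fix r assume "r \<in> {r. 0 \<le> r \<and> (\<exists>c. cball c r \<subseteq> convex hull S)}"
  then obtain c where r: "0 \<le> r" "cball c r \<subseteq> convex hull S" by blast
  have "c + r *\<^sub>R axis 3 1 \<in> cball c r" "c - r *\<^sub>R axis 3 1 \<in> cball c r"
    using r(1) by (simp_all add: dist_norm)
  then have "(c + r *\<^sub>R axis 3 1) $ 3 \<le> h" "0 \<le> (c - r *\<^sub>R axis 3 1) $ 3"
    using slab r(2) by blast+
  then show "r \<le> h / 2" by (simp add: axis_def)
qed

section \<open>Angles of thin tetrahedra\<close>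

text \<open>The angle depends only on directions, and the direction of \<open>s u + w\<close> tends to that of \<open>\<plusminus>u\<close> when
  \<open>w\<close> becomes negligible against \<open>u\<close>. The limit is \<open>0\<close> or \<open>\<pi>\<close> according to the sign of \<open>s\<close>.\<close>

lemma vec_angle_tendsto:
  fixes u w :: "nat \<Rightarrow> real^3"
  assumes nz: "\<And>k. u k \<noteq> 0" and s: "s \<noteq> 0"
    and small: "(\<lambda>k. norm (w k) / norm (u k)) \<longlonglongrightarrow> 0"
  shows "(\<lambda>k. vec_angle (u k) (s *\<^sub>R u k + w k)) \<longlonglongrightarrow> arccos (sgn s)"
proof -
  define v where "v k = s *\<^sub>R u k + w k" for k
  define U where "U k = (1 / norm (u k)) *\<^sub>R u k" for k
  define W where "W k = (1 / norm (u k)) *\<^sub>R w k" for k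
  have nU: "norm (U k) = 1" for k using nz[of k] by (simp add: U_def)
  have W0: "(\<lambda>k. norm (W k)) \<longlonglongrightarrow> 0" using small by (simp add: W_def)
  have vUW: "v k = norm (u k) *\<^sub>R (s *\<^sub>R U k + W k)" for k
    using nz[of k] by (simp add: U_def W_def v_def algebra_simps)
  have uU: "u k = norm (u k) *\<^sub>R U k" for k
    using nz[of k] by (simp add: U_def)
  have cos_eq: "u k \<bullet> v k / (norm (u k) * norm (v k)) = (s + U k \<bullet> W k) / norm (s *\<^sub>R U k + W k)" for k
  proof -
    have "u k \<bullet> v k = norm (u k) * norm (u k) * (s + U k \<bullet> W k)"
      using nU[of k] unfolding vUW[of k]
      by (subst uU) (simp add: inner_add_right dot_square_norm algebra_simps)
    moreover have "norm (v k) = norm (u k) * norm (s *\<^sub>R U k + W k)"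
      by (simp add: vUW[of k])
    ultimately show ?thesis using nz[of k] by simp
  qed
  have "(\<lambda>k. U k \<bullet> W k) \<longlonglongrightarrow> 0"
  proof (rule Lim_null_comparison[OF _ W0], intro always_eventually allI)
    show "norm (U k \<bullet> W k) \<le> norm (W k)" for k
      using Cauchy_Schwarz_ineq2[of "U k" "W k"] nU[of k] by simp
  qed
  then have num: "(\<lambda>k. s + U k \<bullet> W k) \<longlonglongrightarrow> s + 0" by (intro tendsto_intros)
  have "(\<lambda>k. norm (s *\<^sub>R U k + W k) - \<bar>s\<bar>) \<longlonglongrightarrow> 0"
  proof (rule Lim_null_comparison[OF _ W0], intro always_eventually allI)
    show "norm (norm (s *\<^sub>R U k + W k) - \<bar>s\<bar>) \<le> norm (W k)" for k
      using norm_triangle_ineq3[of "s *\<^sub>R U k + W k" "s *\<^sub>R U k"] nU[of k] by simp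
  qed
  then have den: "(\<lambda>k. norm (s *\<^sub>R U k + W k)) \<longlonglongrightarrow> \<bar>s\<bar>" by (simp add: LIM_zero_iff)
  have "(\<lambda>k. (s + U k \<bullet> W k) / norm (s *\<^sub>R U k + W k)) \<longlonglongrightarrow> (s + 0) / \<bar>s\<bar>"
    using num den s by (intro tendsto_divide) auto
  then have "(\<lambda>k. u k \<bullet> v k / (norm (u k) * norm (v k))) \<longlonglongrightarrow> sgn s"
    unfolding cos_eq using s by (simp add: sgn_real_def abs_if split: if_splits)
  moreover have "u k \<bullet> v k / (norm (u k) * norm (v k)) \<in> {-1..1}" for k
  proof -
    have "\<bar>u k \<bullet> v k / (norm (u k) * norm (v k))\<bar> \<le> 1"
      using Cauchy_Schwarz_ineq2[of "u k" "v k"]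
      by (cases "v k = 0") (use nz[of k] in \<open>auto simp: abs_mult divide_le_eq_1\<close>)
    then show ?thesis unfolding abs_le_iff atLeastAtMost_iff by linarith
  qed
  ultimately have "(\<lambda>k. arccos (u k \<bullet> v k / (norm (u k) * norm (v k)))) \<longlonglongrightarrow> arccos (sgn s)"
    using s by (intro continuous_on_tendsto_compose[OF continuous_on_arccos'])
      (auto simp: sgn_real_def)
  then show ?thesis by (simp add: vec_angle_def v_def)
qed

lemma orth_part_linear:
  "orth_part d (a *\<^sub>R v + b *\<^sub>R w) = a *\<^sub>R orth_part d v + b *\<^sub>R orth_part d w"
  by (simp add: orth_part_def inner_add_left algebra_simps add_divide_distrib)

lemma orth_part_self [simp]: "orth_part d d = 0"
  by (cases "d = 0") (simp_all add: orth_part_def)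

text \<open>Both sides are the area of the parallelogram spanned by \<open>d\<close> and \<open>v\<close>.\<close>

lemma norm_orth_part_cross: "norm (orth_part d v) * norm d = norm (cross3 d v)"
proof (cases "d = 0")
  case False
  then have dd: "d \<bullet> d \<noteq> 0" by simp
  have "(norm (orth_part d v) * norm d)\<^sup>2 = (orth_part d v \<bullet> orth_part d v) * (d \<bullet> d)"
    by (simp add: power_mult_distrib power2_norm_eq_inner)
  also have "\<dots> = (v \<bullet> v) * (d \<bullet> d) - (v \<bullet> d)\<^sup>2"
    using dd by (simp add: orth_part_def inner_diff_left inner_diff_right inner_commute[of d v]
        field_simps power2_eq_square)
  also have "\<dots> = (norm (cross3 d v))\<^sup>2"
    using norm_cross_dot[of d v]
    by (simp add: power_mult_distrib power2_norm_eq_inner inner_commute[of d v] algebra_simps)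
  finally show ?thesis by (rule power2_eq_imp_eq) simp_all
qed simp

lemma norm_orth_part_le: "norm (orth_part d v) \<le> norm v"
proof (cases "d = 0")
  case False
  have "(norm (cross3 d v))\<^sup>2 \<le> (norm d * norm v)\<^sup>2"
    using norm_cross_dot[of d v] by (smt (verit) zero_le_power2)
  then have "norm (cross3 d v) \<le> norm d * norm v"
    by (rule power2_le_imp_le) simp
  then show ?thesis
    unfolding norm_orth_part_cross[symmetric] using False by (simp add: mult.commute)
qed (simp add: orth_part_def)

abbreviation e3 :: "real^3" where "e3 \<equiv> axis 3 1"

text \<open>The distance of \<open>v\<close> from the line along \<open>d\<close> is at least the area of the horizontal shadow
  divided by the length of \<open>d\<close>.\<close>

lemma norm_orth_part_ge: "\<bar>cross3 d v \<bullet> e3\<bar> / norm d \<le> norm (orth_part d v)"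
proof (cases "d = 0")
  case False
  have "\<bar>cross3 d v \<bullet> e3\<bar> \<le> norm (cross3 d v)"
    using Cauchy_Schwarz_ineq2[of "cross3 d v" e3] by simp
  then show ?thesis
    unfolding norm_orth_part_cross[symmetric] using False by (simp add: divide_le_eq)
qed simp

text \<open>In projection along the base edge \<open>x\<close>, the apex differs by \<open>\<zeta>\<close> from a positive multiple of the
  projected third base vertex, whose length is at least the area of the horizontal shadow divided
  by the length of \<open>x\<close>. The
  multiple of \<open>x\<close> in the position of the apex disappears in this projection.\<close>

lemma dihedral_angle_tendsto_0:
  fixes A x g :: "nat \<Rightarrow> real^3" and \<zeta> :: "nat \<Rightarrow> real"
  assumes area: "\<And>k. cross3 (x k) (g k) \<bullet> e3 \<noteq> 0"
    and flat: "(\<lambda>k. \<zeta> k * norm (x k) / \<bar>cross3 (x k) (g k) \<bullet> e3\<bar>) \<longlonglongrightarrow> 0"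
    and \<alpha>: "\<alpha> > 0"
  shows "(\<lambda>k. dihedral_angle (A k) (A k + x k) (A k + g k)
      (A k + (\<beta> *\<^sub>R x k + \<alpha> *\<^sub>R g k + \<zeta> k *\<^sub>R e3))) \<longlonglongrightarrow> 0"
proof -
  define u where "u k = orth_part (x k) (g k)" for k
  define w where "w k = \<zeta> k *\<^sub>R orth_part (x k) e3" for k
  have x0: "x k \<noteq> 0" for k using area[of k] by auto
  have u0: "\<bar>cross3 (x k) (g k) \<bullet> e3\<bar> / norm (x k) \<le> norm (u k)" for k
    unfolding u_def by (rule norm_orth_part_ge)
  moreover have pos: "0 < \<bar>cross3 (x k) (g k) \<bullet> e3\<bar> / norm (x k)" for k
    using area[of k] x0[of k] by simp
  ultimately have unz: "u k \<noteq> 0" for k by (metis norm_zero not_le)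
  have small: "(\<lambda>k. norm (w k) / norm (u k)) \<longlonglongrightarrow> 0"
  proof (rule Lim_null_comparison)
    show "(\<lambda>k. \<bar>\<zeta> k * norm (x k) / \<bar>cross3 (x k) (g k) \<bullet> e3\<bar>\<bar>) \<longlonglongrightarrow> 0"
      using flat by (rule tendsto_rabs_zero)
    have "norm (w k) \<le> \<bar>\<zeta> k\<bar>" for k
      using norm_orth_part_le[of "x k" e3] by (simp add: w_def mult_left_le)
    then have "norm (w k) / norm (u k) \<le> \<bar>\<zeta> k\<bar> / (\<bar>cross3 (x k) (g k) \<bullet> e3\<bar> / norm (x k))" for k
      using u0[of k] pos[of k] by (intro frac_le) auto
    then show "\<forall>\<^sub>F k in sequentially. norm (norm (w k) / norm (u k))
        \<le> \<bar>\<zeta> k * norm (x k) / \<bar>cross3 (x k) (g k) \<bullet> e3\<bar>\<bar>"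
      by (simp add: abs_mult)
  qed
  have eq: "orth_part (x k) (\<beta> *\<^sub>R x k + \<alpha> *\<^sub>R g k + \<zeta> k *\<^sub>R e3) = \<alpha> *\<^sub>R u k + w k" for k
    using orth_part_linear[of "x k" 1 "\<beta> *\<^sub>R x k + \<alpha> *\<^sub>R g k" "\<zeta> k" e3]
      orth_part_linear[of "x k" \<beta> "x k" \<alpha> "g k"]
    by (simp add: u_def w_def)
  have "(\<lambda>k. vec_angle (u k) (\<alpha> *\<^sub>R u k + w k)) \<longlonglongrightarrow> arccos (sgn \<alpha>)"
    using \<alpha> by (intro vec_angle_tendsto unz small) simp
  then show ?thesis using \<alpha> by (simp add: dihedral_angle_def eq u_def)
qed

text \<open>The point below the apex lies on the ray from \<open>A\<close> towards the middle between the ends of \<open>x\<close> and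
  \<open>g\<close>. In projection along the edge \<open>c\<close> from \<open>A\<close> to the apex, \<open>x + g\<close> therefore almost vanishes, so
  \<open>x\<close> and \<open>g\<close> point in almost opposite directions.\<close>

lemma dihedral_angle_tendsto_pi:
  fixes A x g :: "nat \<Rightarrow> real^3" and \<zeta> :: "nat \<Rightarrow> real"
  assumes area: "\<And>k. cross3 (x k) (g k) \<bullet> e3 \<noteq> 0"
    and \<alpha>: "\<alpha> > 0" and c: "\<And>k. c k = \<alpha> *\<^sub>R (x k + g k) + \<zeta> k *\<^sub>R e3"
    and flat: "(\<lambda>k. \<zeta> k * norm (c k) / \<bar>cross3 (x k) (g k) \<bullet> e3\<bar>) \<longlonglongrightarrow> 0"
  shows "(\<lambda>k. dihedral_angle (A k) (A k + c k) (A k + x k) (A k + g k)) \<longlonglongrightarrow> pi"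
proof -
  define u where "u k = orth_part (c k) (x k)" for k
  define w where "w k = - (\<zeta> k / \<alpha>) *\<^sub>R orth_part (c k) e3" for k
  have cx: "cross3 (c k) (x k) \<bullet> e3 = - \<alpha> * (cross3 (x k) (g k) \<bullet> e3)" for k
    using cross_skew[of "g k" "x k"]
    by (simp add: c cross_add_left cross_mult_left inner_add_left inner_diff_left dot_cross_self)
  have c0: "c k \<noteq> 0" for k using cx[of k] area[of k] \<alpha> by auto
  have u0: "\<alpha> * \<bar>cross3 (x k) (g k) \<bullet> e3\<bar> / norm (c k) \<le> norm (u k)" for k
    using norm_orth_part_ge[of "c k" "x k"] \<alpha> unfolding u_def cx by (simp add: abs_mult)
  moreover have pos: "0 < \<alpha> * \<bar>cross3 (x k) (g k) \<bullet> e3\<bar> / norm (c k)" for k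
    using area[of k] c0[of k] \<alpha> by simp
  ultimately have unz: "u k \<noteq> 0" for k by (metis norm_zero not_le)
  have small: "(\<lambda>k. norm (w k) / norm (u k)) \<longlonglongrightarrow> 0"
  proof (rule Lim_null_comparison)
    show "(\<lambda>k. \<bar>1 / \<alpha>\<^sup>2 * (\<zeta> k * norm (c k) / \<bar>cross3 (x k) (g k) \<bullet> e3\<bar>)\<bar>) \<longlonglongrightarrow> 0"
      using flat by (intro tendsto_rabs_zero tendsto_mult_right_zero)
    have "norm (w k) \<le> \<bar>\<zeta> k\<bar> / \<alpha>" for k
      using norm_orth_part_le[of "c k" e3] \<alpha> by (simp add: w_def mult_left_le divide_right_mono)
    then have "norm (w k) / norm (u k)
        \<le> (\<bar>\<zeta> k\<bar> / \<alpha>) / (\<alpha> * \<bar>cross3 (x k) (g k) \<bullet> e3\<bar> / norm (c k))" for k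
      using u0[of k] pos[of k] \<alpha> by (intro frac_le) auto
    then show "\<forall>\<^sub>F k in sequentially. norm (norm (w k) / norm (u k))
        \<le> \<bar>1 / \<alpha>\<^sup>2 * (\<zeta> k * norm (c k) / \<bar>cross3 (x k) (g k) \<bullet> e3\<bar>)\<bar>"
      using \<alpha> by (simp add: abs_mult power2_eq_square mult.commute mult.assoc)
  qed
  have eq: "orth_part (c k) (g k) = (-1) *\<^sub>R u k + w k" for k
  proof -
    have "0 = orth_part (c k) (\<alpha> *\<^sub>R (x k + g k) + \<zeta> k *\<^sub>R e3)"
      by (simp only: c[symmetric] orth_part_self)
    also have "\<dots> = \<alpha> *\<^sub>R (u k + orth_part (c k) (g k)) + \<zeta> k *\<^sub>R orth_part (c k) e3"
      using orth_part_linear[of "c k" \<alpha> "x k + g k" "\<zeta> k" e3]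
        orth_part_linear[of "c k" 1 "x k" 1 "g k"] by (simp add: u_def)
    finally have "\<alpha> *\<^sub>R (u k + orth_part (c k) (g k)) = - \<zeta> k *\<^sub>R orth_part (c k) e3"
      by (simp only: eq_neg_iff_add_eq_0 scaleR_minus_left)
    then have "(1 / \<alpha>) *\<^sub>R \<alpha> *\<^sub>R (u k + orth_part (c k) (g k)) = w k"
      by (simp add: w_def)
    then show ?thesis using \<alpha> by (simp add: algebra_simps)
  qed
  have "(\<lambda>k. vec_angle (u k) ((-1) *\<^sub>R u k + w k)) \<longlonglongrightarrow> arccos (sgn (-1))"
    by (intro vec_angle_tendsto unz small) simp
  then show ?thesis unfolding dihedral_angle_def add_diff_cancel_left' eq by (simp add: u_def)
qed

text \<open>The vertex of the angle lies at height \<open>\<zeta> / 2\<close> above the midpoint of the segment from \<open>P\<close> to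
  \<open>P + y\<close>, whose endpoints are seen from there in almost opposite directions.\<close>

lemma planar_angle_tendsto_pi:
  fixes P y :: "nat \<Rightarrow> real^3" and \<zeta> :: "nat \<Rightarrow> real"
  assumes nz: "\<And>k. y k \<noteq> 0" and planar: "\<And>k. y k \<bullet> e3 = 0"
    and flat: "(\<lambda>k. \<zeta> k / norm (y k)) \<longlonglongrightarrow> 0"
  shows "(\<lambda>k. planar_angle (P k + (1 / 2) *\<^sub>R (y k + \<zeta> k *\<^sub>R e3)) (P k) (P k + y k)) \<longlonglongrightarrow> pi"
proof -
  define u where "u k = - (1 / 2) *\<^sub>R (y k + \<zeta> k *\<^sub>R e3)" for k
  define w where "w k = - \<zeta> k *\<^sub>R e3" for k
  have u0: "norm (y k) / 2 \<le> norm (u k)" for k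
  proof -
    have "(norm (y k + \<zeta> k *\<^sub>R e3))\<^sup>2 = (norm (y k))\<^sup>2 + (\<zeta> k)\<^sup>2"
      using planar[of k]
      by (simp only: power2_norm_eq_inner inner_add_left inner_add_right inner_commute[of e3 "y k"]
          inner_scaleR_left inner_scaleR_right inner_axis_axis) (simp add: power2_eq_square)
    then have "(norm (y k))\<^sup>2 \<le> (norm (y k + \<zeta> k *\<^sub>R e3))\<^sup>2" by simp
    then have "norm (y k) \<le> norm (y k + \<zeta> k *\<^sub>R e3)" by (rule power2_le_imp_le) simp
    then show ?thesis unfolding u_def norm_scaleR by linarith
  qed
  have unz: "u k \<noteq> 0" for k using u0[of k] nz[of k] by auto
  have small: "(\<lambda>k. norm (w k) / norm (u k)) \<longlonglongrightarrow> 0"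
  proof (rule Lim_null_comparison)
    show "(\<lambda>k. \<bar>2 * (\<zeta> k / norm (y k))\<bar>) \<longlonglongrightarrow> 0"
      using flat by (intro tendsto_rabs_zero tendsto_mult_right_zero)
    have "norm (w k) / norm (u k) \<le> \<bar>\<zeta> k\<bar> / (norm (y k) / 2)" for k
      using u0[of k] nz[of k] by (intro frac_le) (auto simp: w_def)
    then show "\<forall>\<^sub>F k in sequentially. norm (norm (w k) / norm (u k)) \<le> \<bar>2 * (\<zeta> k / norm (y k))\<bar>"
      by (simp add: abs_mult mult.commute)
  qed
  have half: "(1 / 2) *\<^sub>R v + (1 / 2) *\<^sub>R v = v" for v :: "real^3"
    using scaleR_half_double[of v] by (simp only: scaleR_add_right)
  have "P k - (P k + (1 / 2) *\<^sub>R (y k + \<zeta> k *\<^sub>R e3)) = u k" for k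
    by (simp add: u_def)
  moreover have "(P k + y k) - (P k + (1 / 2) *\<^sub>R (y k + \<zeta> k *\<^sub>R e3)) = (-1) *\<^sub>R u k + w k" for k
  proof -
    define h where "h = (1 / 2) *\<^sub>R (y k + \<zeta> k *\<^sub>R e3)"
    have "h + h = y k + \<zeta> k *\<^sub>R e3" unfolding h_def by (rule half)
    then have "y k - h = h - \<zeta> k *\<^sub>R e3" by (simp add: algebra_simps)
    moreover have "(-1) *\<^sub>R u k + w k = h - \<zeta> k *\<^sub>R e3" by (simp add: u_def w_def h_def)
    ultimately show ?thesis by (simp add: h_def)
  qed
  moreover have "(\<lambda>k. vec_angle (u k) ((-1) *\<^sub>R u k + w k)) \<longlonglongrightarrow> arccos (sgn (-1))"
    by (intro vec_angle_tendsto unz small) simp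
  ultimately show ?thesis by (simp only: planar_angle_def) simp
qed

section \<open>Sequences built from two alternating kinds of tetrahedra\<close>

lemma unique_longest_edge:
  assumes "triple A B C D \<noteq> 0"
    and lt: "dist A C < dist A B" "dist A D < dist A B" "dist B C < dist A B"
      "dist B D < dist A B" "dist C D < dist A B"
    and e: "longest_edge (convex hull {A, B, C, D}) e"
  shows "e = closed_segment A B"
proof -
  have "longest_pair A B C D" using lt by (intro longest_pairI) simp_all
  from iffD1[OF longest_edge_hull_iff[OF assms(1) this] e]
  obtain P Q where PQ: "P \<in> {A, B, C, D}" "Q \<in> {A, B, C, D}" "e = closed_segment P Q"
      "dist P Q = dist A B" by (elim bexE conjE)
  have ne: "dist A C \<noteq> dist A B" "dist A D \<noteq> dist A B" "dist B C \<noteq> dist A B"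
      "dist B D \<noteq> dist A B" "dist C D \<noteq> dist A B" "dist C A \<noteq> dist A B" "dist D A \<noteq> dist A B"
      "dist C B \<noteq> dist A B" "dist D B \<noteq> dist A B" "dist D C \<noteq> dist A B"
    using lt by (simp_all add: dist_commute)
  have "\<forall>P\<in>{A, B, C, D}. \<forall>Q\<in>{A, B, C, D}. dist P Q = dist A B \<longrightarrow> P = A \<and> Q = B \<or> P = B \<and> Q = A"
    using triple_nonzero_distinct[OF assms(1)] by (simp add: ne)
  then have "P = A \<and> Q = B \<or> P = B \<and> Q = A"
    using PQ(1,2,4) by blast
  then show ?thesis using PQ(3) closed_segment_commute by auto
qed

text \<open>The vertices are compared as sets, since the endpoint that is kept and the edge that is cut next
  change from step to step.\<close>

lemma two_phase_sequence:
  fixes A B C D A' B' C' D' :: "nat \<Rightarrow> real^3"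
  assumes n: "2 \<le> n"
    and T_even: "\<And>k. T (2 * k) = convex hull {A k, B k, C k, D k}"
    and e_even: "\<And>k. e (2 * k) = closed_segment (A k) (B k)"
    and T_odd: "\<And>k. T (Suc (2 * k)) = convex hull {A' k, B' k, C' k, D' k}"
    and e_odd: "\<And>k. e (Suc (2 * k)) = closed_segment (A' k) (B' k)"
    and nz: "\<And>k. triple (A k) (B k) (C k) (D k) \<noteq> 0"
    and nz': "\<And>k. triple (A' k) (B' k) (C' k) (D' k) \<noteq> 0"
    and longest: "\<And>k. longest_pair (A k) (B k) (C k) (D k)"
    and longest': "\<And>k. longest_pair (A' k) (B' k) (C' k) (D' k)"
    and step: "\<And>k. {A' k, B' k, C' k, D' k} = {A k, A k + (1 / real n) *\<^sub>R (B k - A k), C k, D k}"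
    and step': "\<And>k. {A (Suc k), B (Suc k), C (Suc k), D (Suc k)}
      = {A' k, A' k + (1 / real n) *\<^sub>R (B' k - A' k), C' k, D' k}"
  shows "tetrahedron (T m) \<and> T (Suc m) \<subset> T m \<and> longest_edge (T m) (e m) \<and>
    T (Suc m) \<in> children n (T m) (e m)"
proof -
  have one: "tetrahedron (convex hull {P, Q, R, S}) \<and>
      convex hull {P, P + (1 / real n) *\<^sub>R (Q - P), R, S} \<subset> convex hull {P, Q, R, S} \<and>
      longest_edge (convex hull {P, Q, R, S}) (closed_segment P Q) \<and>
      convex hull {P, P + (1 / real n) *\<^sub>R (Q - P), R, S}
        \<in> children n (convex hull {P, Q, R, S}) (closed_segment P Q)"
    if "triple P Q R S \<noteq> 0" "longest_pair P Q R S" for P Q R S :: "real^3"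
  proof (intro conjI)
    have "\<exists>P'\<in>{P, Q, R, S}. \<exists>Q'\<in>{P, Q, R, S}.
        closed_segment P Q = closed_segment P' Q' \<and> dist P' Q' = dist P Q"
      by (rule bexI[of _ P], rule bexI[of _ Q]) simp_all
    then show "longest_edge (convex hull {P, Q, R, S}) (closed_segment P Q)"
      by (rule iffD2[OF longest_edge_hull_iff[OF that]])
    show "tetrahedron (convex hull {P, Q, R, S})" by (rule tetrahedron_hull[OF that(1)])
    show "convex hull {P, P + (1 / real n) *\<^sub>R (Q - P), R, S} \<subset> convex hull {P, Q, R, S}"
      by (rule first_child_psubset[OF n that(1)])
    show "convex hull {P, P + (1 / real n) *\<^sub>R (Q - P), R, S}
        \<in> children n (convex hull {P, Q, R, S}) (closed_segment P Q)"
      by (rule first_child) (use n in linarith)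
  qed
  show ?thesis
  proof (cases "even m")
    case True
    then obtain k where k: "m = 2 * k" by blast
    show ?thesis unfolding k T_even e_even T_odd step by (rule one[OF nz longest])
  next
    case False
    then obtain k where k: "m = Suc (2 * k)" by (metis oddE Suc_eq_plus1)
    have "T (Suc m) = convex hull {A (Suc k), B (Suc k), C (Suc k), D (Suc k)}"
      using T_even[of "Suc k"] by (simp add: k)
    then have TS: "T (Suc m) = convex hull {A' k, A' k + (1 / real n) *\<^sub>R (B' k - A' k), C' k, D' k}"
      unfolding step' .
    show ?thesis unfolding TS unfolding k T_odd e_odd by (rule one[OF nz' longest'])
  qed
qed

text \<open>The slab bounds the inradius from above and one edge bounds the diameter from below. It is
  enough to have such bounds at the start of each period.\<close>

lemma diameter_inradius_unbounded:
  fixes T :: "nat \<Rightarrow> (real^3) set"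
  assumes T_even: "\<And>k. T (2 * k) = convex hull {A k, B k, C k, D k}"
    and nz: "\<And>k. triple (A k) (B k) (C k) (D k) \<noteq> 0"
    and slab: "\<And>k P. P \<in> {A k, B k, C k, D k} \<Longrightarrow> 0 \<le> P $ 3 \<and> P $ 3 \<le> \<zeta> k"
    and flat: "(\<lambda>k. \<zeta> k / dist (A k) (B k)) \<longlonglongrightarrow> 0"
  shows "\<not> (\<exists>C. \<forall>k. diameter (T k) / inradius (T k) \<le> C)"
proof
  assume "\<exists>C. \<forall>k. diameter (T k) / inradius (T k) \<le> C"
  then obtain K where K: "\<And>k. diameter (T k) / inradius (T k) \<le> K" by blast
  have "0 < 1 / (\<bar>K\<bar> + 1)" by simp
  from order_tendstoD(2)[OF flat this]
  obtain k where k: "\<zeta> k / dist (A k) (B k) < 1 / (\<bar>K\<bar> + 1)"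
    by (auto simp: eventually_sequentially)
  have AB: "0 < dist (A k) (B k)"
    using triple_nonzero_distinct[OF nz[of k]] by simp
  have r: "0 < inradius (T (2 * k))" "inradius (T (2 * k)) \<le> \<zeta> k / 2"
    unfolding T_even using inradius_pos[OF nz[of k]]
      inradius_le_slab[of "{A k, B k, C k, D k}" "\<zeta> k"] slab[of _ k] by auto
  have "bounded (T (2 * k))"
    unfolding T_even by (simp add: finite_imp_bounded bounded_convex_hull)
  then have "dist (A k) (B k) \<le> diameter (T (2 * k))"
    unfolding T_even by (intro diameter_bounded_bound) (auto simp: hull_inc)
  also have "\<dots> \<le> K * inradius (T (2 * k))"
    using K[of "2 * k"] r(1) by (simp add: divide_le_eq)
  also have "\<dots> \<le> (\<bar>K\<bar> + 1) * \<zeta> k"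
    using r by (intro mult_mono) auto
  finally show False
    using k AB by (simp add: field_simps)
qed

lemma limit_0_not_bounded_below:
  fixes \<theta> :: "nat \<Rightarrow> real"
  assumes "\<And>k. \<theta> k \<in> S (m k)" "\<theta> \<longlonglongrightarrow> 0"
  shows "\<not> (\<exists>\<alpha>>0. \<forall>k. \<forall>\<theta>\<in>S k. \<theta> \<ge> \<alpha>)"
proof
  assume "\<exists>\<alpha>>0. \<forall>k. \<forall>\<theta>\<in>S k. \<theta> \<ge> \<alpha>"
  then obtain \<alpha> where "\<alpha> > 0" "\<And>k \<theta>. \<theta> \<in> S k \<Longrightarrow> \<theta> \<ge> \<alpha>" by blast
  then show False
    using order_tendstoD(2)[OF assms(2), of \<alpha>] assms(1)
    by (meson eventually_sequentially not_le order_refl)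
qed

lemma limit_not_bounded_above:
  fixes \<theta> :: "nat \<Rightarrow> real"
  assumes "\<And>k. \<theta> k \<in> S (m k)" "\<theta> \<longlonglongrightarrow> l"
  shows "\<not> (\<exists>\<alpha><l. \<forall>k. \<forall>\<theta>\<in>S k. \<theta> \<le> \<alpha>)"
proof
  assume "\<exists>\<alpha><l. \<forall>k. \<forall>\<theta>\<in>S k. \<theta> \<le> \<alpha>"
  then obtain \<alpha> where "\<alpha> < l" "\<And>k \<theta>. \<theta> \<in> S k \<Longrightarrow> \<theta> \<le> \<alpha>" by blast
  then show False
    using order_tendstoD(1)[OF assms(2), of \<alpha>] assms(1)
    by (meson eventually_sequentially not_le order_refl)
qed

lemma dihedral_angle_in_angles:
  assumes "triple A B C D \<noteq> 0" "{P, Q, R, S} \<subseteq> {A, B, C, D}" "distinct [P, Q, R, S]"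
  shows "dihedral_angle P Q R S \<in> angles (convex hull {A, B, C, D})"
  unfolding angles_def vertices_hull[OF assms(1)]
  by (rule UnI2, rule CollectI, rule exI[of _ P], rule exI[of _ Q], rule exI[of _ R], rule exI[of _ S])
    (use assms(2,3) in simp)

lemma planar_angle_in_angles:
  assumes "triple A B C D \<noteq> 0" "{P, Q, R} \<subseteq> {A, B, C, D}" "distinct [P, Q, R]"
  shows "planar_angle P Q R \<in> angles (convex hull {A, B, C, D})"
  unfolding angles_def vertices_hull[OF assms(1)]
  by (rule UnI1, rule CollectI, rule exI[of _ P], rule exI[of _ Q], rule exI[of _ R])
    (use assms(2,3) in simp)

text \<open>If \<open>x\<close> is the longer of two edges of the base, the area is at most the square of its length;
  hence being thin relative to area over length implies being thin relative to length.\<close>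

lemma flat_relative_to_edge:
  fixes x g :: "nat \<Rightarrow> real^3" and \<zeta> :: "nat \<Rightarrow> real"
  assumes area: "\<And>k. cross3 (x k) (g k) \<bullet> e3 \<noteq> 0" and le: "\<And>k. norm (g k) \<le> norm (x k)"
    and pos: "\<And>k. 0 \<le> \<zeta> k"
    and flat: "(\<lambda>k. \<zeta> k * norm (x k) / \<bar>cross3 (x k) (g k) \<bullet> e3\<bar>) \<longlonglongrightarrow> 0"
  shows "(\<lambda>k. \<zeta> k / norm (x k)) \<longlonglongrightarrow> 0"
proof (rule Lim_null_comparison[OF _ flat], intro always_eventually allI)
  fix k
  have x0: "0 < norm (x k)" using area[of k] by auto
  have "\<bar>cross3 (x k) (g k) \<bullet> e3\<bar> / norm (x k) \<le> norm (orth_part (x k) (g k))"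
    by (rule norm_orth_part_ge)
  also have "\<dots> \<le> norm (x k)" using norm_orth_part_le[of "x k" "g k"] le[of k] by linarith
  finally have "\<bar>cross3 (x k) (g k) \<bullet> e3\<bar> / norm (x k) \<le> norm (x k)" .
  then have "\<zeta> k / norm (x k) \<le> \<zeta> k / (\<bar>cross3 (x k) (g k) \<bullet> e3\<bar> / norm (x k))"
    using area[of k] x0 pos[of k] by (intro divide_left_mono) auto
  then show "norm (\<zeta> k / norm (x k)) \<le> \<zeta> k * norm (x k) / \<bar>cross3 (x k) (g k) \<bullet> e3\<bar>"
    using pos[of k] by simp
qed

section \<open>Three or more parts: a base in a narrow cone\<close>

lemma triple_add: "triple A (A + b) (A + c) (A + d) = cross3 b c \<bullet> d"
  by (simp add: triple_def)

lemma inner_diff_self: "(u - v) \<bullet> (u - v) = u \<bullet> u - 2 * (u \<bullet> v) + v \<bullet> v" for u v :: "real^3"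
  by (simp add: inner_diff_left inner_diff_right inner_commute[of v u])

text \<open>If \<open>g = t x\<close>, these inequalities say \<open>1 / 2 \<le> t \<le> m / (m + 1)\<close>. They are linear in the three
  products, so they can be checked coordinate by coordinate for an orbit with real ratios, and they
  also make sense for the rotating orbit that occurs for \<open>m = 3\<close>.\<close>

definition needle_cone :: "real \<Rightarrow> real^3 \<Rightarrow> real^3 \<Rightarrow> bool" where
  "needle_cone m x g \<longleftrightarrow> x \<bullet> x \<le> 2 * (x \<bullet> g) \<and> (m + 1) * (x \<bullet> g) \<le> m * (x \<bullet> x) \<and>
     (m + 1) * (g \<bullet> g) \<le> m * (x \<bullet> g) \<and> x \<bullet> x \<le> 4 * (g \<bullet> g)"

text \<open>Here \<open>m\<close> is the number of parts, the base has the edge vectors \<open>x\<close> and \<open>g\<close> at the vertex that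
  is kept, and \<open>c\<close> leads from there to the apex. The first five inequalities say that \<open>x\<close> is the
  longest edge before the first section, the last five that \<open>c\<close> is the longest one after it, when
  \<open>x\<close> is replaced by \<open>x / m\<close>. The bound on \<open>\<zeta>\<close> keeps \<open>c\<close> shorter than \<open>x\<close>; the strict inequality
  between \<open>g\<close> and \<open>c\<close> comes from \<open>\<zeta> > 0\<close>, since without height the cone allows them to be equal.\<close>

lemma lifted_triangle_lengths:
  fixes x g :: "real^3" and m \<zeta> :: real
  defines "c \<equiv> (m / (2 * m + 1)) *\<^sub>R (x + g) + \<zeta> *\<^sub>R e3"
  assumes m: "3 \<le> m"
    and x3: "x \<bullet> e3 = 0" and g3: "g \<bullet> e3 = 0" and x0: "0 < x \<bullet> x"
    and cone: "needle_cone m x g"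
    and \<zeta>: "0 < \<zeta>" "((2 * m + 1) * \<zeta>)\<^sup>2 \<le> x \<bullet> x"
  shows "norm g < norm x" "norm c < norm x" "norm (x - g) < norm x"
    "norm (x - c) < norm x" "norm (g - c) < norm x"
    "norm g < norm c" "norm ((1 / m) *\<^sub>R x) < norm c" "norm (c - g) < norm c"
    "norm (c - (1 / m) *\<^sub>R x) < norm c" "norm (g - (1 / m) *\<^sub>R x) < norm c"
proof -
  \<comment> \<open>Everything is a linear inequality between \<open>D, X, B, z\<close> and their multiples by
    \<open>m\<close> and \<open>m\<^sup>2\<close>, once denominators \<open>N\<close> are cleared.\<close>
  define D X B N z a where "D = x \<bullet> x" and "X = x \<bullet> g" and "B = g \<bullet> g" and "N = 2 * m + 1"
    and "z = (N * \<zeta>)\<^sup>2" and "a = c \<bullet> c"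
  have N: "0 < N" using m by (simp add: N_def)
  have D0: "0 < D" and X1: "D \<le> 2 * X" and X2: "(m + 1) * X \<le> m * D" and B1: "(m + 1) * B \<le> m * X"
    and B2: "D \<le> 4 * B" and z: "0 < z" "z \<le> D"
    using x0 cone[unfolded needle_cone_def] \<zeta> N by (simp_all add: D_def X_def B_def z_def N_def)
  have X0: "0 < X" and B0: "0 < B" using D0 X1 B2 by linarith+
  have XD: "X < D"
  proof -
    have "(m + 1) * X < (m + 1) * D" using X2 D0 by (simp add: distrib_right)
    then show ?thesis using m by simp
  qed
  have BX: "B < X"
  proof -
    have "(m + 1) * B < (m + 1) * X" using B1 X0 by (simp add: distrib_right)
    then show ?thesis using m by simp
  qed
  have mX: "m * X \<le> m * D" "m * B \<le> m * X" "m * m * X \<le> m * m * D" "m * m * B \<le> m * m * X"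
    "0 < m * D" "0 < m * m * D" "0 < m * X" "0 < m * B" "0 < m * m * B" "0 < m * m * X"
    using XD BX m D0 X0 B0 by simp_all
  define \<alpha> where "\<alpha> = m / N"
  have c: "c = \<alpha> *\<^sub>R (x + g) + \<zeta> *\<^sub>R e3" by (simp add: c_def \<alpha>_def N_def)
  have N\<alpha>: "N * \<alpha> = m" using N by (simp add: \<alpha>_def)
  have mD: "3 * D \<le> m * D" "3 * (m * D) \<le> m * m * D"
    using mult_right_mono[OF m, of D] mult_right_mono[OF m, of "m * D"] m D0 by simp_all
  have cx: "N * (c \<bullet> x) = m * (D + X)" and cg: "N * (c \<bullet> g) = m * (X + B)"
    unfolding N\<alpha>[symmetric] using x3 g3
    by (simp_all add: c D_def X_def B_def inner_add_left inner_commute[of g x] inner_commute[of e3])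
  have a: "N * N * a = m * m * (D + 2 * X + B) + z"
  proof -
    have "a = \<alpha> * \<alpha> * (D + 2 * X + B) + \<zeta> * \<zeta>"
      using x3 g3 by (simp add: a_def c D_def X_def B_def inner_add_left inner_add_right
          inner_commute[of g x] inner_commute[of e3] inner_axis_axis algebra_simps)
    then have "N * N * a = (N * \<alpha>) * (N * \<alpha>) * (D + 2 * X + B) + (N * \<zeta>) * (N * \<zeta>)"
      by (simp add: algebra_simps)
    then show ?thesis by (simp add: N\<alpha> z_def power2_eq_square)
  qed
  have NN: "N * N = 4 * m * m + 4 * m + 1" by (simp add: N_def algebra_simps)
  have NND: "N * N * D = 4 * (m * m * D) + 4 * (m * D) + D"
    unfolding NN by (simp add: algebra_simps)
  have a': "N * N * a = m * m * D + 2 * (m * m * X) + m * m * B + z"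
    unfolding a by (simp add: algebra_simps)
  have NNpos: "0 < N * N" using N by simp
  have aB: "B < a"
  proof -
    have "(m + 1) * ((m + 1) * B) \<le> (m + 1) * (m * X)"
      using B1 m by (intro mult_left_mono) simp_all
    moreover have "m * ((m + 1) * X) \<le> m * (m * D)"
      using X2 m by (intro mult_left_mono) simp_all
    moreover have "m * ((m + 1) * B) \<le> m * (m * X)"
      using B1 m by (intro mult_left_mono) simp_all
    ultimately have "N * N * B < N * N * a"
      unfolding a unfolding NN using z by (simp add: algebra_simps)
    then show ?thesis using NNpos mult_less_cancel_left_pos by blast
  qed
  have aD: "a < D"
  proof -
    have "N * N * a < N * N * D"
      unfolding a' NND using mX mD z D0 by linarith
    then show ?thesis using NNpos mult_less_cancel_left_pos by blast
  qed
  have Dm: "(1 / m) * ((1 / m) * D) \<le> B"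
  proof -
    have "3 * 3 \<le> m * m" using m by (intro mult_mono) simp_all
    then have "9 * B \<le> m * m * B" using B0 by (intro mult_right_mono) simp_all
    then have "D \<le> m * m * B" using B2 B0 by linarith
    then show ?thesis using m by (simp add: field_simps)
  qed
  show "norm g < norm x" unfolding norm_lt using BX XD by (simp add: D_def B_def)
  show "norm c < norm x" unfolding norm_lt using aD by (simp add: D_def a_def)
  show "norm (x - g) < norm x"
    unfolding norm_lt inner_diff_self using BX X0 by (simp add: D_def B_def X_def)
  show "norm (x - c) < norm x"
  proof -
    have "N * N * (2 * (c \<bullet> x)) = 2 * N * (N * (c \<bullet> x))" by (simp add: algebra_simps)
    also have "\<dots> = 2 * N * (m * (D + X))" by (simp only: cx)
    also have "\<dots> = 4 * (m * m * D) + 4 * (m * m * X) + 2 * (m * D) + 2 * (m * X)"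
      by (simp add: N_def algebra_simps)
    also have "N * N * a < \<dots>"
      unfolding a' using mX mD z D0 by linarith
    finally have "N * N * a < N * N * (2 * (c \<bullet> x))" .
    then have "a < 2 * (c \<bullet> x)" using NNpos mult_less_cancel_left_pos by blast
    then show ?thesis
      unfolding norm_lt inner_diff_self by (simp add: a_def inner_commute[of x c])
  qed
  show "norm (g - c) < norm x"
  proof -
    have "N * N * (B - 2 * (c \<bullet> g) + a) = N * N * B - 2 * N * (N * (c \<bullet> g)) + N * N * a"
      by (simp add: algebra_simps)
    also have "\<dots> = (2 * (m * B) + B - 4 * (m * m * X) - 2 * (m * X)) + N * N * a"
      unfolding cg by (simp add: N_def algebra_simps)
    also have "\<dots> < N * N * D"
      unfolding a' NND using mX mD z D0 XD BX by linarith
    finally have "B - 2 * (c \<bullet> g) + a < D" using NNpos mult_less_cancel_left_pos by blast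
    then show ?thesis
      unfolding norm_lt inner_diff_self by (simp add: a_def B_def D_def inner_commute[of g c])
  qed
  show "norm g < norm c" unfolding norm_lt using aB by (simp add: a_def B_def)
  show "norm ((1 / m) *\<^sub>R x) < norm c"
    unfolding norm_lt using aB Dm by (simp add: a_def D_def)
  show "norm (c - g) < norm c"
  proof -
    have "N * (2 * (c \<bullet> g)) = 2 * (N * (c \<bullet> g))" by simp
    also have "\<dots> = 2 * (m * (X + B))" by (simp only: cg)
    also have "\<dots> = 2 * (m * X) + 2 * (m * B)" by (simp add: algebra_simps)
    also have "N * B < \<dots>"
    proof -
      have "N * B = 2 * (m * B) + B" by (simp add: N_def algebra_simps)
      then show ?thesis using mult_right_mono[OF m, of X] X0 BX by linarith
    qed
    finally have "N * B < N * (2 * (c \<bullet> g))" .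
    then have "B < 2 * (c \<bullet> g)" using N mult_less_cancel_left_pos by blast
    then show ?thesis unfolding norm_lt inner_diff_self by (simp add: B_def)
  qed
  show "norm (c - (1 / m) *\<^sub>R x) < norm c"
  proof -
    have "N * D < N * (2 * (m * (c \<bullet> x)))"
    proof -
      have "N * (2 * (m * (c \<bullet> x))) = 2 * m * (N * (c \<bullet> x))" by simp
      moreover have "2 * m * (m * (D + X)) = 2 * (m * m * D) + 2 * (m * m * X)" "N * D = 2 * (m * D) + D"
        by (simp_all add: N_def algebra_simps)
      ultimately show ?thesis
        unfolding cx using mX mD by linarith
    qed
    then have "D < 2 * (m * (c \<bullet> x))" using N mult_less_cancel_left_pos by blast
    then have "(1 / m) * ((1 / m) * D) < 2 * ((1 / m) * (c \<bullet> x))"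
      using m by (simp add: field_simps)
    then show ?thesis unfolding norm_lt inner_diff_self by (simp add: D_def)
  qed
  show "norm (g - (1 / m) *\<^sub>R x) < norm c"
  proof -
    have "D \<le> 2 * (m * X)" using X1 X0 mult_right_mono[OF m, of X] by linarith
    then have "(1 / m) * ((1 / m) * D) \<le> 2 * ((1 / m) * X)"
      using m by (simp add: field_simps)
    then show ?thesis
      unfolding norm_lt inner_diff_self using aB
      by (simp add: a_def D_def B_def X_def inner_commute[of g x])
  qed
qed

text \<open>One coordinate of the orbit of edge vectors.\<close>

fun orbit :: "real \<Rightarrow> real \<Rightarrow> real \<Rightarrow> nat \<Rightarrow> real" where
  "orbit m a b 0 = a"
| "orbit m a b (Suc 0) = b"
| "orbit m a b (Suc (Suc k)) = orbit m a b (Suc k) - orbit m a b k / m"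

text \<open>The ratio of consecutive terms changes by \<open>t \<mapsto> 1 - 1 / (m t)\<close>, which maps the interval from
  \<open>1 / 2\<close> to \<open>m / (m + 1)\<close> into itself if \<open>m \<ge> 4\<close>.\<close>

lemma orbit_ratio:
  assumes m: "4 \<le> m" and a: "0 < a" and b: "a \<le> 2 * b" "(m + 1) * b \<le> m * a"
  shows "0 < orbit m a b k \<and> orbit m a b k \<le> 2 * orbit m a b (Suc k) \<and>
    (m + 1) * orbit m a b (Suc k) \<le> m * orbit m a b k"
proof (induction k)
  case 0
  then show ?case using a b by simp
next
  case (Suc k)
  define u v where "u = orbit m a b k" and "v = orbit m a b (Suc k)"
  have uv: "0 < u" "u \<le> 2 * v" "(m + 1) * v \<le> m * u"
    using Suc by (simp_all add: u_def v_def)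
  have "u / m \<le> u / 4" using m uv(1) by (intro divide_left_mono) simp_all
  moreover have "v < u"
  proof -
    have "(m + 1) * v < (m + 1) * u" using uv by (simp add: distrib_right)
    then show ?thesis using m by simp
  qed
  moreover have "(m + 1) * (u / m) = u + u / m" using m by (simp add: field_simps)
  moreover have "0 < u / m" using m uv(1) by simp
  ultimately have "0 < v" "v \<le> 2 * (v - u / m)" "(m + 1) * (v - u / m) \<le> m * v"
    using uv by (simp_all add: algebra_simps)
  then show ?case by (simp add: u_def v_def)
qed

text \<open>For \<open>n \<ge> 4\<close> both coordinates run through positive real orbits, with different initial ratios
  so that the two edge vectors are linearly independent. For \<open>n = 3\<close> no real ratio persists. There
  the initial vectors are chosen such that the recurrence acts as a similarity, a rotation by a twelfth
  of a full turn scaled by \<open>1 / \<surd>3\<close>, and the products keep the ratios \<open>6 : 3 : 2\<close>.\<close>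

lemma planar_orbit_exists:
  fixes n :: nat
  assumes n: "3 \<le> n"
  shows "\<exists>y :: nat \<Rightarrow> real^3. (\<forall>k. y k \<bullet> e3 = 0) \<and>
    (\<forall>k. y (Suc (Suc k)) = y (Suc k) - (1 / real n) *\<^sub>R y k) \<and>
    (\<forall>k. needle_cone (real n) (y k) (y (Suc k))) \<and>
    cross3 (y 0) (y (Suc 0)) \<bullet> e3 \<noteq> 0 \<and> 1 \<le> y 0 \<bullet> y 0"
proof -
  define y :: "real \<Rightarrow> real \<Rightarrow> nat \<Rightarrow> real^3" where
    "y v0 v1 k = vector [orbit n 1 (1 / 2) k, orbit n v0 v1 k, 0]" for v0 v1 k
  have planar: "y v0 v1 k \<bullet> e3 = 0" for v0 v1 k
    by (simp add: y_def inner_axis)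
  have rec: "y v0 v1 (Suc (Suc k)) = y v0 v1 (Suc k) - (1 / real n) *\<^sub>R y v0 v1 k" for v0 v1 k
    by (simp add: y_def vec_eq_iff forall_3)
  have inner: "y v0 v1 j \<bullet> y v0 v1 k
      = orbit n 1 (1 / 2) j * orbit n 1 (1 / 2) k + orbit n v0 v1 j * orbit n v0 v1 k" for v0 v1 j k
    by (simp add: y_def inner_vec_def sum_3)
  have cross: "cross3 (y v0 v1 0) (y v0 v1 (Suc 0)) \<bullet> e3 = v1 - v0 / 2" for v0 v1
    by (simp add: y_def cross3_def inner_axis)
  show ?thesis
  proof (cases "n = 3")
    case True
    let ?y = "y 0 (sqrt 3 / 6)"
    have gram: "?y (Suc k) \<bullet> ?y (Suc k) = ?y k \<bullet> ?y k / 3 \<and> ?y k \<bullet> ?y (Suc k) = ?y k \<bullet> ?y k / 2" for k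
    proof (induction k)
      case 0
      then show ?case by (simp add: inner True)
    next
      case (Suc k)
      define u v where "u = ?y k" and "v = ?y (Suc k)"
      have w: "?y (Suc (Suc k)) = v - (1 / 3) *\<^sub>R u" by (simp add: rec True u_def v_def)
      have "v \<bullet> ?y (Suc (Suc k)) = v \<bullet> v - (u \<bullet> v) / 3"
        unfolding w by (simp add: inner_diff_right inner_commute[of v u])
      moreover have "?y (Suc (Suc k)) \<bullet> ?y (Suc (Suc k)) = v \<bullet> v - 2 * (u \<bullet> v) / 3 + (u \<bullet> u) / 9"
        unfolding w inner_diff_self by (simp add: inner_commute[of v u])
      moreover have "v \<bullet> v = (u \<bullet> u) / 3 \<and> u \<bullet> v = (u \<bullet> u) / 2"
        using Suc by (simp only: u_def v_def)
      ultimately show ?case by (simp add: v_def)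
    qed
    have "needle_cone (real n) (?y k) (?y (Suc k))" for k
    proof -
      define D where "D = ?y k \<bullet> ?y k"
      have D: "?y (Suc k) \<bullet> ?y (Suc k) = D / 3" "?y k \<bullet> ?y (Suc k) = D / 2" "0 \<le> D"
        using gram[of k] by (simp_all add: D_def)
      show ?thesis unfolding needle_cone_def D_def[symmetric] D(1,2) using D(3) by (simp add: True)
    qed
    moreover have "1 \<le> ?y 0 \<bullet> ?y 0" by (simp add: inner)
    ultimately show ?thesis
      using planar rec cross[of 0 "sqrt 3 / 6"] by (intro exI[of _ ?y]) auto
  next
    case False
    then have n4: "4 \<le> real n" using n by simp
    let ?y = "y 1 (3 / 4)" and ?u = "orbit n 1 (1 / 2)" and ?v = "orbit n 1 (3 / 4)"
    have ratios: "0 < ?u k \<and> ?u k \<le> 2 * ?u (Suc k) \<and> (real n + 1) * ?u (Suc k) \<le> real n * ?u k"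
      "0 < ?v k \<and> ?v k \<le> 2 * ?v (Suc k) \<and> (real n + 1) * ?v (Suc k) \<le> real n * ?v k" for k
      using n4 by (intro orbit_ratio; simp)+
    \<comment> \<open>the contribution of one coordinate to each of the inequalities of the cone\<close>
    have one: "s * s \<le> 2 * (s * t)" "(m + 1) * (s * t) \<le> m * (s * s)"
      "(m + 1) * (t * t) \<le> m * (s * t)" "s * s \<le> 4 * (t * t)"
      if h: "0 < s \<and> s \<le> 2 * t \<and> (m + 1) * t \<le> m * s" for m s t :: real
    proof -
      have t: "0 < t" using h by linarith
      show "s * s \<le> 2 * (s * t)" using mult_left_mono[of s "2 * t" s] h by simp
      show "(m + 1) * (s * t) \<le> m * (s * s)"
        using mult_left_mono[of "(m + 1) * t" "m * s" s] h by (simp add: algebra_simps)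
      show "(m + 1) * (t * t) \<le> m * (s * t)"
        using mult_left_mono[of "(m + 1) * t" "m * s" t] h t by (simp add: algebra_simps)
      show "s * s \<le> 4 * (t * t)" using mult_mono[of s "2 * t" s "2 * t"] h t by simp
    qed
    have "needle_cone (real n) (?y k) (?y (Suc k))" for k
      using one[OF ratios(1)[of k]] one[OF ratios(2)[of k]]
      by (simp only: needle_cone_def inner distrib_left) linarith
    moreover have "1 \<le> ?y 0 \<bullet> ?y 0" by (simp add: inner)
    ultimately show ?thesis
      using planar rec cross[of 1 "3 / 4"] by (intro exI[of _ ?y]) auto
  qed
qed

text \<open>The cone bounds the ratio of consecutive lengths from both sides: by \<open>1 / 2\<close> from below, so the
  height \<open>n\<^sup>-\<^sup>k\<close> never outgrows the base, and by \<open>n / (n + 1)\<close> from above, so the diameter tends to \<open>0\<close>.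
  A step of the recurrence has determinant \<open>1 / n\<close>, which gives the area.\<close>

lemma flattening_orbit_properties:
  fixes y :: "nat \<Rightarrow> real^3" and n :: nat
  assumes n: "3 \<le> n"
    and rec: "\<And>k. y (Suc (Suc k)) = y (Suc k) - (1 / real n) *\<^sub>R y k"
    and cone: "\<And>k. needle_cone (real n) (y k) (y (Suc k))"
    and y0: "1 \<le> y 0 \<bullet> y 0"
  shows "(1 / 4) ^ k \<le> y k \<bullet> y k" "y \<longlonglongrightarrow> 0"
    "cross3 (y k) (y (Suc k)) = (1 / real n) ^ k *\<^sub>R cross3 (y 0) (y (Suc 0))"
proof -
  show "(1 / 4) ^ k \<le> y k \<bullet> y k"
  proof (induction k)
    case (Suc k)
    then show ?case using cone[of k] by (simp add: needle_cone_def)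
  qed (use y0 in simp)
  show "cross3 (y k) (y (Suc k)) = (1 / real n) ^ k *\<^sub>R cross3 (y 0) (y (Suc 0))"
  proof (induction k)
    case (Suc k)
    have "cross3 (y (Suc k)) (y (Suc (Suc k))) = (1 / real n) *\<^sub>R cross3 (y k) (y (Suc k))"
      unfolding rec using cross_skew[of "y k" "y (Suc k)"]
      by (simp add: Cross3.right_diff_distrib cross_mult_right)
    then show ?case using Suc by simp
  qed simp
  define r where "r = real n / (real n + 1)"
  have r: "0 < r" "r < 1" using n by (simp_all add: r_def)
  have contract: "norm (y (Suc k)) \<le> r * norm (y k)" for k
  proof -
    define X where "X = y k \<bullet> y (Suc k)"
    have "y (Suc k) \<bullet> y (Suc k) \<le> r * X" "X \<le> r * (y k \<bullet> y k)"
      using cone[of k] n by (simp_all add: needle_cone_def X_def r_def field_simps)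
    then have "y (Suc k) \<bullet> y (Suc k) \<le> r * (r * (y k \<bullet> y k))"
      using r mult_left_mono[of X "r * (y k \<bullet> y k)" r] by linarith
    then have "(norm (y (Suc k)))\<^sup>2 \<le> (r * norm (y k))\<^sup>2"
      by (simp add: power_mult_distrib power2_norm_eq_inner power2_eq_square[of r] mult.assoc)
    then show ?thesis by (rule power2_le_imp_le) (use r in simp)
  qed
  have bound: "norm (y k) \<le> norm (y 0) * r ^ k" for k
  proof (induction k)
    case (Suc k)
    have "norm (y (Suc k)) \<le> r * (norm (y 0) * r ^ k)"
      using contract[of k] mult_left_mono[OF Suc, of r] r by linarith
    then show ?case by (simp add: mult.left_commute)
  qed simp
  have "(\<lambda>k. norm (y 0) * r ^ k) \<longlonglongrightarrow> 0"
    using r by (intro tendsto_mult_right_zero LIMSEQ_power_zero) simp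
  then show "y \<longlonglongrightarrow> 0"
    by (rule Lim_null_comparison[rotated]) (use bound in simp)
qed

text \<open>With the base vertex \<open>A\<close> of the period as origin, a period maps \<open>(x, g, c)\<close> to
  \<open>(- g, x / n - g, c / n - g)\<close> and the origin to \<open>A + g\<close>. The value of \<open>\<alpha>\<close> is the one for which
  \<open>c = \<alpha> (x + g)\<close> up to height is preserved.\<close>

lemma flattening_nsection_sequence:
  fixes n :: nat
  assumes n: "3 \<le> n"
  shows "\<exists>(T :: nat \<Rightarrow> (real^3) set) (e :: nat \<Rightarrow> (real^3) set).
     (\<forall>k. tetrahedron (T k) \<and> T (Suc k) \<subset> T k \<and> longest_edge (T k) (e k) \<and>
       T (Suc k) \<in> children n (T k) (e k)) \<and>
     \<not> (\<exists>C. \<forall>k. diameter (T k) / inradius (T k) \<le> C) \<and>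
     \<not> (\<exists>\<alpha>>0. \<forall>k. \<forall>\<theta>\<in>angles (T k). \<theta> \<ge> \<alpha>) \<and>
     \<not> (\<exists>\<alpha><pi. \<forall>k. \<forall>\<theta>\<in>angles (T k). \<theta> \<le> \<alpha>) \<and>
     (\<forall>k e'. longest_edge (T k) e' \<longrightarrow> e' = e k)"
proof -
  obtain y :: "nat \<Rightarrow> real^3" where planar: "\<And>k. y k \<bullet> e3 = 0"
    and rec: "\<And>k. y (Suc (Suc k)) = y (Suc k) - (1 / real n) *\<^sub>R y k"
    and cone: "\<And>k. needle_cone (real n) (y k) (y (Suc k))"
    and area0: "cross3 (y 0) (y (Suc 0)) \<bullet> e3 \<noteq> 0" and y0: "1 \<le> y 0 \<bullet> y 0"
    using planar_orbit_exists[OF n] by auto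
  note props = flattening_orbit_properties[OF n rec cone y0]
  define N where "N = 2 * real n + 1"
  define \<alpha> where "\<alpha> = real n / N"
  define \<zeta> where "\<zeta> k = (1 / real n) ^ k / N" for k
  \<comment> \<open>In terms of the points \<open>p\<^sub>k\<close>, \<open>A k\<close> is \<open>p\<^bsub>k+1\<^esub>\<close>, and from it \<open>x k\<close>, \<open>g k\<close> and \<open>c k\<close> lead to \<open>p\<^bsub>k\<^esub>\<close>,
    \<open>p\<^bsub>k+2\<^esub>\<close> and the apex. The alternating sign reflects that a period moves the base vertex
    to the far end of \<open>g k\<close>, from which the next triangle is seen reversed.\<close>
  define x g c A where "x k = (-1) ^ k *\<^sub>R y k" and "g k = (-1) ^ k *\<^sub>R y (Suc k)"
    and c: "c k = \<alpha> *\<^sub>R (x k + g k) + \<zeta> k *\<^sub>R e3"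
    and "A k = (\<Sum>i<k. g i)" for k
  have N: "0 < N" by (simp add: N_def)
  have \<zeta>: "0 < \<zeta> k" for k using n N by (simp add: \<zeta>_def)
  have \<alpha>: "0 < \<alpha>" using n N by (simp add: \<alpha>_def)
  have A_Suc: "A (Suc k) = A k + g k" for k by (simp add: A_def)
  have x_Suc: "x (Suc k) = - g k" for k by (simp add: x_def g_def)
  have g_Suc: "g (Suc k) = (1 / real n) *\<^sub>R x k - g k" for k
    by (simp add: x_def g_def rec scaleR_right_diff_distrib)
  have c_Suc: "g k + c (Suc k) = (1 / real n) *\<^sub>R c k" for k
  proof -
    have "1 - 2 * \<alpha> = (N - 2 * real n) / N" using N by (simp add: \<alpha>_def diff_divide_distrib)
    also have "\<dots> = \<alpha> / real n" using n by (simp add: \<alpha>_def N_def)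
    finally have "(1 - 2 * \<alpha>) * g k $ i = (\<alpha> / real n) * g k $ i" for i by simp
    then show ?thesis
      by (simp add: vec_eq_iff c \<zeta>_def x_Suc g_Suc algebra_simps)
  qed
  have x3: "x k \<bullet> e3 = 0" and g3: "g k \<bullet> e3 = 0" for k by (simp_all add: x_def g_def planar)
  have sq: "(-1) ^ k * ((-1) ^ k * t) = t" for k and t :: real
    by (cases "even k") simp_all
  have xx: "x k \<bullet> x k = y k \<bullet> y k" and xg: "x k \<bullet> g k = y k \<bullet> y (Suc k)"
    and gg: "g k \<bullet> g k = y (Suc k) \<bullet> y (Suc k)" for k
    by (simp_all add: x_def g_def sq)
  have area: "cross3 (x k) (g k) \<bullet> e3 = (1 / real n) ^ k * (cross3 (y 0) (y (Suc 0)) \<bullet> e3)" for k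
    unfolding x_def g_def cross_mult_left cross_mult_right props(3)[of k] by (simp add: sq)
  have area_nz: "cross3 (x k) (g k) \<bullet> e3 \<noteq> 0" for k
    using area0 n by (simp add: area)
  have \<zeta>_le: "((2 * real n + 1) * \<zeta> k)\<^sup>2 \<le> x k \<bullet> x k" for k
  proof -
    have "(2 * real n + 1) * \<zeta> k = (1 / real n) ^ k"
      unfolding N_def[symmetric] using N by (simp add: \<zeta>_def)
    then have "((2 * real n + 1) * \<zeta> k)\<^sup>2 = ((1 / real n)\<^sup>2) ^ k"
      by (simp only: power_mult[symmetric] mult.commute)
    also have "\<dots> \<le> (1 / 4) ^ k"
    proof (rule power_mono)
      have "(1 / real n)\<^sup>2 \<le> (1 / 2)\<^sup>2"
        using n by (intro power_mono divide_left_mono) auto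
      then show "(1 / real n)\<^sup>2 \<le> 1 / 4" by (simp add: power2_eq_square)
    qed simp
    also have "\<dots> \<le> x k \<bullet> x k" unfolding xx by (rule props(1))
    finally show ?thesis .
  qed
  have x_pos: "0 < x k \<bullet> x k" for k
    unfolding xx using props(1)[of k] by (smt (verit) zero_less_power divide_pos_pos)
  have cone_xg: "needle_cone (real n) (x k) (g k)" for k
    using cone[of k] by (simp only: needle_cone_def xx xg gg)
  have n3: "3 \<le> real n" using n by simp
  note len' = lifted_triangle_lengths[OF n3 x3 g3 x_pos cone_xg \<zeta> \<zeta>_le,
      folded N_def, folded \<alpha>_def, folded c]
  have len: "norm (g k) < norm (x k)" "norm (c k) < norm (x k)" "norm (x k - g k) < norm (x k)"
    "norm (x k - c k) < norm (x k)" "norm (g k - c k) < norm (x k)"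
    "norm (g k) < norm (c k)" "norm ((1 / real n) *\<^sub>R x k) < norm (c k)" "norm (c k - g k) < norm (c k)"
    "norm (c k - (1 / real n) *\<^sub>R x k) < norm (c k)" "norm (g k - (1 / real n) *\<^sub>R x k) < norm (c k)" for k
    by (rule len')+
  define T where "T m = (let k = m div 2 in if even m
      then convex hull {A k, A k + x k, A k + g k, A k + c k}
      else convex hull {A k, A k + c k, A k + g k, A k + (1 / real n) *\<^sub>R x k})" for m
  define e where "e m = (let k = m div 2 in if even m
      then closed_segment (A k) (A k + x k) else closed_segment (A k) (A k + c k))" for m
  have T_even: "T (2 * k) = convex hull {A k, A k + x k, A k + g k, A k + c k}"
    and e_even: "e (2 * k) = closed_segment (A k) (A k + x k)"
    and T_odd: "T (Suc (2 * k)) = convex hull {A k, A k + c k, A k + g k, A k + (1 / real n) *\<^sub>R x k}"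
    and e_odd: "e (Suc (2 * k)) = closed_segment (A k) (A k + c k)" for k
    by (simp_all add: T_def e_def Let_def)
  have xgc: "cross3 (x k) (g k) \<bullet> c k = \<zeta> k * (cross3 (x k) (g k) \<bullet> e3)" for k
    by (simp add: c inner_add_right dot_cross_self)
  have nz: "triple (A k) (A k + x k) (A k + g k) (A k + c k) \<noteq> 0" for k
    using \<zeta>[of k] area_nz[of k] by (simp add: triple_add xgc)
  have nz': "triple (A k) (A k + c k) (A k + g k) (A k + (1 / real n) *\<^sub>R x k) \<noteq> 0" for k
  proof -
    have "cross3 (c k) (g k) \<bullet> x k = - (cross3 (x k) (g k) \<bullet> c k)"
      using cross_triple[of "c k" "g k" "x k"] cross_skew[of "g k" "x k"] by simp
    then show ?thesis
      using \<zeta>[of k] area_nz[of k] n by (simp add: triple_add xgc)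
  qed
  have seq: "tetrahedron (T m) \<and> T (Suc m) \<subset> T m \<and> longest_edge (T m) (e m) \<and>
      T (Suc m) \<in> children n (T m) (e m)" for m
  proof (rule two_phase_sequence[OF _ T_even e_even T_odd e_odd nz nz'])
    show "longest_pair (A k) (A k + x k) (A k + g k) (A k + c k)" for k
      using len[of k] by (intro longest_pairI) (simp_all add: dist_norm)
    show "longest_pair (A k) (A k + c k) (A k + g k) (A k + (1 / real n) *\<^sub>R x k)" for k
      using len[of k] by (intro longest_pairI) (simp_all add: dist_norm)
    show "{A k, A k + c k, A k + g k, A k + (1 / real n) *\<^sub>R x k} =
        {A k, A k + (1 / real n) *\<^sub>R (A k + x k - A k), A k + g k, A k + c k}" for k
      by auto
    have "A (Suc k) + x (Suc k) = A k" "A (Suc k) + g (Suc k) = A k + (1 / real n) *\<^sub>R x k"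
      "A (Suc k) + c (Suc k) = A k + (1 / real n) *\<^sub>R c k" for k
      by (simp_all add: A_Suc x_Suc g_Suc add.assoc c_Suc)
    then show "{A (Suc k), A (Suc k) + x (Suc k), A (Suc k) + g (Suc k), A (Suc k) + c (Suc k)} =
        {A k, A k + (1 / real n) *\<^sub>R (A k + c k - A k), A k + g k, A k + (1 / real n) *\<^sub>R x k}" for k
      unfolding A_Suc[symmetric] by (auto simp: A_Suc)
  qed (use n in simp)
  have flat: "(\<lambda>k. \<zeta> k * norm (x k) / \<bar>cross3 (x k) (g k) \<bullet> e3\<bar>) \<longlonglongrightarrow> 0"
  proof -
    have nx: "norm (x k) = norm (y k)" for k by (simp add: x_def)
    have "\<zeta> k * norm (x k) / \<bar>cross3 (x k) (g k) \<bullet> e3\<bar>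
        = 1 / (N * \<bar>cross3 (y 0) (y (Suc 0)) \<bullet> e3\<bar>) * norm (y k)" for k
      unfolding area nx using n by (simp add: \<zeta>_def abs_mult)
    then show ?thesis
      using props(2) by (simp only:) (intro tendsto_mult_right_zero tendsto_norm_zero)
  qed
  have i: "\<not> (\<exists>C. \<forall>k. diameter (T k) / inradius (T k) \<le> C)"
  proof (rule diameter_inradius_unbounded[where T = T and A = A and B = "\<lambda>k. A k + x k"
        and C = "\<lambda>k. A k + g k" and D = "\<lambda>k. A k + c k", OF T_even nz])
    have z3: "v $ 3 = v \<bullet> e3" for v :: "real^3" by (simp add: inner_axis)
    have "A k \<bullet> e3 = 0" for k by (simp add: A_def inner_sum_left g3)
    then show "0 \<le> P $ 3 \<and> P $ 3 \<le> \<zeta> k" if "P \<in> {A k, A k + x k, A k + g k, A k + c k}" for k P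
      using that \<zeta>[of k] unfolding z3
      by (auto simp: inner_add_left x3 g3 c inner_axis_axis)
    show "(\<lambda>k. \<zeta> k / dist (A k) (A k + x k)) \<longlonglongrightarrow> 0"
      using flat_relative_to_edge[OF area_nz _ _ flat] len(1) \<zeta> by (simp add: dist_norm less_imp_le)
  qed
  have ii: "\<not> (\<exists>\<alpha>>0. \<forall>k. \<forall>\<theta>\<in>angles (T k). \<theta> \<ge> \<alpha>)"
  proof (rule limit_0_not_bounded_below)
    show "dihedral_angle (A k) (A k + x k) (A k + g k) (A k + c k) \<in> angles (T (2 * k))" for k
      unfolding T_even by (rule dihedral_angle_in_angles[OF nz])
        (use triple_nonzero_distinct[OF nz[of k]] in simp_all)
    have "c k = \<alpha> *\<^sub>R x k + \<alpha> *\<^sub>R g k + \<zeta> k *\<^sub>R e3" for k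
      by (simp add: c scaleR_add_right)
    then show "(\<lambda>k. dihedral_angle (A k) (A k + x k) (A k + g k) (A k + c k)) \<longlonglongrightarrow> 0"
      using dihedral_angle_tendsto_0[OF area_nz flat \<alpha>] by simp
  qed
  have iii: "\<not> (\<exists>\<alpha><pi. \<forall>k. \<forall>\<theta>\<in>angles (T k). \<theta> \<le> \<alpha>)"
  proof (rule limit_not_bounded_above)
    show "dihedral_angle (A k) (A k + c k) (A k + x k) (A k + g k) \<in> angles (T (2 * k))" for k
      unfolding T_even by (rule dihedral_angle_in_angles[OF nz])
        (use triple_nonzero_distinct[OF nz[of k]] in auto)
    have "(\<lambda>k. \<zeta> k * norm (c k) / \<bar>cross3 (x k) (g k) \<bullet> e3\<bar>) \<longlonglongrightarrow> 0"
    proof (rule Lim_null_comparison[OF _ flat], intro always_eventually allI)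
      show "norm (\<zeta> k * norm (c k) / \<bar>cross3 (x k) (g k) \<bullet> e3\<bar>)
          \<le> \<zeta> k * norm (x k) / \<bar>cross3 (x k) (g k) \<bullet> e3\<bar>" for k
        using len(2)[of k] \<zeta>[of k] by (simp add: divide_right_mono)
    qed
    then show "(\<lambda>k. dihedral_angle (A k) (A k + c k) (A k + x k) (A k + g k)) \<longlonglongrightarrow> pi"
      by (rule dihedral_angle_tendsto_pi[OF area_nz \<alpha> c])
  qed
  have unique: "e' = e m" if "longest_edge (T m) e'" for m e'
  proof (cases "even m")
    case True
    then obtain k where k: "m = 2 * k" by blast
    show ?thesis unfolding k e_even
      by (rule unique_longest_edge[OF nz[of k]])
        (use len[of k] that in \<open>simp_all add: dist_norm k T_even\<close>)
  next
    case False
    then obtain k where k: "m = Suc (2 * k)" by (metis oddE Suc_eq_plus1)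
    show ?thesis unfolding k e_odd
      by (rule unique_longest_edge[OF nz'[of k]])
        (use len[of k] that in \<open>simp_all add: dist_norm k T_odd\<close>)
  qed
  show ?thesis using seq i ii iii unique by blast
qed

section \<open>Two parts: similar isosceles bases\<close>

text \<open>The recurrence \<open>p\<^bsub>k+3\<^esub> = (p\<^sub>k + p\<^bsub>k+2\<^esub>) / 2\<close> in terms of the differences \<open>f\<^sub>k = p\<^bsub>k+1\<^esub> - p\<^sub>k\<close>. Its
  characteristic roots are complex of modulus \<open>1 / \<surd>2\<close>, and the initial vectors are chosen so that it
  acts as a similarity of the Euclidean plane. The products say that the triangle with edges \<open>f\<^sub>k\<close>
  and \<open>f\<^bsub>k+1\<^esub>\<close> has the two legs \<open>f\<^sub>k\<close> and \<open>f\<^sub>k + f\<^bsub>k+1\<^esub>\<close> of equal length.\<close>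

lemma bisection_orbit_exists:
  "\<exists>f :: nat \<Rightarrow> real^3. (\<forall>k. f k \<bullet> e3 = 0) \<and>
    (\<forall>k. f (Suc (Suc k)) = - (1 / 2) *\<^sub>R (f k + f (Suc k))) \<and>
    (\<forall>k. f k \<bullet> f k = (1 / 2) ^ k \<and> f k \<bullet> f (Suc k) = - (1 / 4) * (1 / 2) ^ k) \<and>
    cross3 (f 0) (f (Suc 0)) \<bullet> e3 \<noteq> 0"
proof -
  \<comment> \<open>a second-order recurrence as iteration on pairs of consecutive terms\<close>
  define s where "s = (\<lambda>(u :: real^3, v :: real^3). (v, - (1 / 2) *\<^sub>R (u + v)))"
  define start :: "(real^3) \<times> (real^3)" where
    "start = (vector [1, 0, 0], vector [- 1 / 4, sqrt 7 / 4, 0])"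
  define f where "f k = fst ((s ^^ k) start)" for k
  have rec: "f (Suc (Suc k)) = - (1 / 2) *\<^sub>R (f k + f (Suc k))" for k
    by (simp add: f_def s_def split: prod.split)
  have f0: "f 0 = vector [1, 0, 0]" by (simp add: f_def start_def)
  have f1: "f (Suc 0) = vector [- 1 / 4, sqrt 7 / 4, 0]" by (simp add: f_def s_def start_def)
  have planar: "f k \<bullet> e3 = 0 \<and> f (Suc k) \<bullet> e3 = 0" for k
    by (induction k) (simp_all add: f0 f1 rec inner_axis inner_add_left)
  have gram: "f k \<bullet> f k = (1 / 2) ^ k \<and> f k \<bullet> f (Suc k) = - (1 / 4) * (1 / 2) ^ k \<and>
      f (Suc k) \<bullet> f (Suc k) = (1 / 2) ^ Suc k" for k
  proof (induction k)
    case 0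
    then show ?case by (simp add: f0 f1 inner_vec_def sum_3)
  next
    case (Suc k)
    have "f (Suc k) \<bullet> f (Suc (Suc k)) = - (f k \<bullet> f (Suc k) + f (Suc k) \<bullet> f (Suc k)) / 2"
      unfolding rec by (simp add: inner_add_right inner_commute[of "f (Suc k)" "f k"] add_divide_distrib)
    moreover have "f (Suc (Suc k)) \<bullet> f (Suc (Suc k))
        = (f k \<bullet> f k + 2 * (f k \<bullet> f (Suc k)) + f (Suc k) \<bullet> f (Suc k)) / 4"
      unfolding rec by (simp add: inner_add_right inner_add_left
          inner_commute[of "f (Suc k)" "f k"] add_divide_distrib diff_divide_distrib)
    ultimately show ?case using Suc by simp
  qed
  have "cross3 (f 0) (f (Suc 0)) \<bullet> e3 \<noteq> 0"
    by (simp add: f0 f1 cross3_def inner_axis)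
  then show ?thesis using rec planar gram by blast
qed

text \<open>Relative to \<open>P k\<close>, the base has the legs \<open>f k\<close> and \<open>b k\<close>, the apex is above the end of \<open>b k\<close>, and
  \<open>m k\<close> is the midpoint of the edge to the apex. The angle close to \<open>\<pi>\<close> occurs in the middle of a
  period, at \<open>m k\<close>, between the ends of the leg \<open>b k\<close>.\<close>

lemma flattening_bisection_sequence:
  "\<exists>(T :: nat \<Rightarrow> (real^3) set) (e :: nat \<Rightarrow> (real^3) set).
     (\<forall>k. tetrahedron (T k) \<and> T (Suc k) \<subset> T k \<and> longest_edge (T k) (e k) \<and>
       T (Suc k) \<in> children 2 (T k) (e k)) \<and>
     \<not> (\<exists>C. \<forall>k. diameter (T k) / inradius (T k) \<le> C) \<and>
     \<not> (\<exists>\<alpha>>0. \<forall>k. \<forall>\<theta>\<in>angles (T k). \<theta> \<ge> \<alpha>) \<and>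
     \<not> (\<exists>\<alpha><pi. \<forall>k. \<forall>\<theta>\<in>angles (T k). \<theta> \<le> \<alpha>) \<and>
     (\<forall>k. \<exists>e1 e2. e1 \<noteq> e2 \<and> longest_edge (T (Suc (2 * k))) e1 \<and> longest_edge (T (Suc (2 * k))) e2)"
proof -
  obtain f :: "nat \<Rightarrow> real^3" where planar: "\<And>k. f k \<bullet> e3 = 0"
    and rec: "\<And>k. f (Suc (Suc k)) = - (1 / 2) *\<^sub>R (f k + f (Suc k))"
    and ff: "\<And>k. f k \<bullet> f k = (1 / 2) ^ k" and fg: "\<And>k. f k \<bullet> f (Suc k) = - (1 / 4) * (1 / 2) ^ k"
    and area0: "cross3 (f 0) (f (Suc 0)) \<bullet> e3 \<noteq> 0"
    using bisection_orbit_exists by auto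
  define P where "P k = (\<Sum>i<k. f i)" for k
  define b where "b k = f k + f (Suc k)" for k
  define \<zeta> :: "nat \<Rightarrow> real" where "\<zeta> k = (1 / 2) ^ k" for k
  define m where "m k = (1 / 2) *\<^sub>R (b k + \<zeta> k *\<^sub>R e3)" for k
  have \<zeta>: "0 < \<zeta> k" for k by (simp add: \<zeta>_def)
  have P_Suc: "P (Suc k) = P k + f k" for k by (simp add: P_def)
  have b3: "b k \<bullet> e3 = 0" for k by (simp add: b_def inner_add_left planar)
  have P3: "P k \<bullet> e3 = 0" for k by (simp add: P_def inner_sum_left planar)
  have bb: "b k \<bullet> b k = (1 / 2) ^ k" for k
    by (simp add: b_def inner_add_left inner_add_right inner_commute[of "f (Suc k)" "f k"] ff fg)
  have bf: "b k \<bullet> f k = 3 / 4 * (1 / 2) ^ k" for k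
    by (simp add: b_def inner_add_left inner_commute[of "f (Suc k)" "f k"] ff fg)
  have e33: "e3 \<bullet> e3 = 1" by (simp add: inner_axis_axis)
  have \<zeta>2: "\<zeta> k * \<zeta> k \<le> (1 / 2) ^ k" for k
    using mult_left_le[of "(1 / 2 :: real) ^ k" "(1 / 2) ^ k"] by (simp add: \<zeta>_def power_le_one)
  have lens: "norm (b k) \<le> norm (b k + \<zeta> k *\<^sub>R e3)" "norm (f k) \<le> norm (b k + \<zeta> k *\<^sub>R e3)"
      "norm (\<zeta> k *\<^sub>R e3) \<le> norm (b k + \<zeta> k *\<^sub>R e3)"
      "norm (b k + \<zeta> k *\<^sub>R e3 - f k) \<le> norm (b k + \<zeta> k *\<^sub>R e3)"
      "norm (b k - f k) \<le> norm (b k + \<zeta> k *\<^sub>R e3)" for k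
    unfolding norm_le using \<zeta>2[of k]
    by (simp_all add: inner_add_left inner_add_right inner_diff_left inner_diff_right
        inner_commute[of e3 "b k"] inner_commute[of e3 "f k"] inner_commute[of "f k" "b k"]
        b3 planar bb bf ff e33)
  have lens': "norm (b k - f k) \<le> norm (b k)" "norm (b k - m k) \<le> norm (b k)"
      "norm (f k) = norm (b k)" "norm (m k) \<le> norm (b k)" "norm (f k - m k) \<le> norm (b k)" for k
    unfolding norm_le norm_eq using \<zeta>2[of k] zero_less_power[of "1 / 2 :: real" k]
    by (simp_all del: zero_less_power add: m_def inner_add_left inner_add_right inner_diff_left inner_diff_right
        inner_commute[of e3 "b k"] inner_commute[of e3 "f k"] inner_commute[of "f k" "b k"]
        b3 planar bb bf ff e33 field_simps)
  have cross_f: "cross3 (f k) (f (Suc k)) = (1 / 2) ^ k *\<^sub>R cross3 (f 0) (f (Suc 0))" for k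
  proof (induction k)
    case (Suc k)
    have "cross3 (f (Suc k)) (f (Suc (Suc k))) = (1 / 2) *\<^sub>R cross3 (f k) (f (Suc k))"
      unfolding rec using cross_skew[of "f k" "f (Suc k)"]
      by (simp add: cross_add_right cross_mult_right)
    then show ?case using Suc by simp
  qed simp
  define \<kappa> where "\<kappa> = cross3 (f 0) (f (Suc 0)) \<bullet> e3"
  have area: "cross3 (- f k) (f (Suc k)) \<bullet> e3 = - ((1 / 2) ^ k * \<kappa>)" for k
    unfolding cross_minus_left cross_f[of k] \<kappa>_def by simp
  have \<kappa>: "\<kappa> \<noteq> 0" using area0 by (simp add: \<kappa>_def)
  have area_nz: "cross3 (- f k) (f (Suc k)) \<bullet> e3 \<noteq> 0" for k
    using \<kappa> unfolding area by simp
  have apex: "cross3 (b k + \<zeta> k *\<^sub>R e3) (b k) \<bullet> f k = - (\<zeta> k * ((1 / 2) ^ k * \<kappa>))" for k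
  proof -
    have "cross3 (b k + \<zeta> k *\<^sub>R e3) (b k) \<bullet> f k = \<zeta> k * (cross3 e3 (b k) \<bullet> f k)"
      by (simp add: cross_add_left cross_mult_left)
    also have "cross3 e3 (b k) \<bullet> f k = cross3 (b k) (f k) \<bullet> e3"
      by (rule cross_triple)
    also have "cross3 (b k) (f k) = cross3 (f (Suc k)) (f k)"
      by (simp add: b_def cross_add_left)
    also have "cross3 (f (Suc k)) (f k) \<bullet> e3 = cross3 (- f k) (f (Suc k)) \<bullet> e3"
      using cross_skew[of "f (Suc k)" "f k"] by simp
    finally show ?thesis unfolding area by simp
  qed
  define T where "T i = (let k = i div 2 in if even i
      then convex hull {P k, P k + (b k + \<zeta> k *\<^sub>R e3), P k + b k, P k + f k}
      else convex hull {P k + b k, P k, P k + f k, P k + m k})" for i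
  define e where "e i = (let k = i div 2 in if even i
      then closed_segment (P k) (P k + (b k + \<zeta> k *\<^sub>R e3)) else closed_segment (P k + b k) (P k))" for i
  have T_even: "T (2 * k) = convex hull {P k, P k + (b k + \<zeta> k *\<^sub>R e3), P k + b k, P k + f k}"
    and e_even: "e (2 * k) = closed_segment (P k) (P k + (b k + \<zeta> k *\<^sub>R e3))"
    and T_odd: "T (Suc (2 * k)) = convex hull {P k + b k, P k, P k + f k, P k + m k}"
    and e_odd: "e (Suc (2 * k)) = closed_segment (P k + b k) (P k)" for k
    by (simp_all add: T_def e_def Let_def)
  have nz: "triple (P k) (P k + (b k + \<zeta> k *\<^sub>R e3)) (P k + b k) (P k + f k) \<noteq> 0" for k
    using \<zeta>[of k] \<kappa> unfolding triple_add apex by simp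
  have nz': "triple (P k + b k) (P k) (P k + f k) (P k + m k) \<noteq> 0" for k
  proof -
    have "triple (P k + b k) (P k) (P k + f k) (P k + m k) = cross3 (- b k) (f k - b k) \<bullet> (m k - b k)"
      by (simp add: triple_def)
    also have "\<dots> = (1 / 2) * (cross3 (f k) (b k) \<bullet> (b k + \<zeta> k *\<^sub>R e3))"
      using cross_skew[of "f k" "b k"]
      by (simp add: m_def Cross3.right_diff_distrib inner_diff_right dot_cross_self)
    also have "cross3 (f k) (b k) \<bullet> (b k + \<zeta> k *\<^sub>R e3) = - (cross3 (b k + \<zeta> k *\<^sub>R e3) (b k) \<bullet> f k)"
      using cross_triple[of "f k" "b k" "b k + \<zeta> k *\<^sub>R e3"] cross_skew[of "b k" "b k + \<zeta> k *\<^sub>R e3"]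
      by simp
    finally have eq: "triple (P k + b k) (P k) (P k + f k) (P k + m k) = \<zeta> k * ((1 / 2) ^ k * \<kappa>) / 2"
      unfolding apex by simp
    show ?thesis unfolding eq using \<zeta>[of k] \<kappa> by simp
  qed
  have d1: "dist p (p + v) = norm v" and d2: "dist (p + v) (p + w) = norm (v - w)"
    for p v w :: "real^3"
    by (simp_all add: dist_norm norm_minus_commute)
  have longest': "longest_pair (P k + b k) (P k) (P k + f k) (P k + m k)" for k
    using lens'[of k] by (intro longest_pairI) (simp_all add: dist_norm)
  have seq: "tetrahedron (T i) \<and> T (Suc i) \<subset> T i \<and> longest_edge (T i) (e i) \<and>
      T (Suc i) \<in> children 2 (T i) (e i)" for i
  proof (rule two_phase_sequence[OF _ T_even e_even T_odd e_odd nz nz' _ longest'])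
    show "longest_pair (P k) (P k + (b k + \<zeta> k *\<^sub>R e3)) (P k + b k) (P k + f k)" for k
      using lens[of k] by (intro longest_pairI) (simp_all only: d1 d2 add_diff_cancel_left')
    show "{P k + b k, P k, P k + f k, P k + m k} = {P k, P k + (1 / real 2) *\<^sub>R
        (P k + (b k + \<zeta> k *\<^sub>R e3) - P k), P k + b k, P k + f k}" for k
      by (auto simp: m_def)
    have "P (Suc k) + (b (Suc k) + \<zeta> (Suc k) *\<^sub>R e3) = P k + m k"
      "P (Suc k) + b (Suc k) = P k + b k + (1 / real 2) *\<^sub>R (P k - (P k + b k))"
      "P (Suc k) + f (Suc k) = P k + b k" for k
      by (simp_all add: vec_eq_iff P_Suc b_def rec m_def \<zeta>_def field_simps)
    then show "{P (Suc k), P (Suc k) + (b (Suc k) + \<zeta> (Suc k) *\<^sub>R e3), P (Suc k) + b (Suc k), P (Suc k) + f (Suc k)}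
      = {P k + b k, P k + b k + (1 / real 2) *\<^sub>R (P k - (P k + b k)), P k + f k, P k + m k}" for k
      unfolding P_Suc[symmetric] by auto
  qed simp
  have flat: "(\<lambda>k. \<zeta> k * norm (- f k) / \<bar>cross3 (- f k) (f (Suc k)) \<bullet> e3\<bar>) \<longlonglongrightarrow> 0"
  proof -
    have nf: "norm (- f k) = sqrt (1 / 2) ^ k" for k
      by (simp add: norm_eq_sqrt_inner ff real_sqrt_power)
    have "\<zeta> k * norm (- f k) / \<bar>cross3 (- f k) (f (Suc k)) \<bullet> e3\<bar> = 1 / \<bar>\<kappa>\<bar> * sqrt (1 / 2) ^ k" for k
      unfolding area nf by (simp add: \<zeta>_def abs_mult)
    moreover have "(\<lambda>k. 1 / \<bar>\<kappa>\<bar> * sqrt (1 / 2) ^ k) \<longlonglongrightarrow> 0"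
      by (intro tendsto_mult_right_zero LIMSEQ_power_zero) simp
    ultimately show ?thesis by simp
  qed
  have "norm (f (Suc k)) \<le> norm (- f k)" for k
    by (simp add: norm_le ff)
  then have flat_f: "(\<lambda>k. \<zeta> k / norm (- f k)) \<longlonglongrightarrow> 0"
    using flat_relative_to_edge[OF area_nz _ _ flat] \<zeta> by (simp add: less_imp_le)
  then have flat_b: "(\<lambda>k. \<zeta> k / norm (b k)) \<longlonglongrightarrow> 0"
    using lens'(3) by simp
  have i: "\<not> (\<exists>C. \<forall>k. diameter (T k) / inradius (T k) \<le> C)"
  proof (rule diameter_inradius_unbounded[where T = T and A = P
        and B = "\<lambda>k. P k + (b k + \<zeta> k *\<^sub>R e3)" and C = "\<lambda>k. P k + b k"
        and D = "\<lambda>k. P k + f k", OF T_even nz])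
    have z3: "v $ 3 = v \<bullet> e3" for v :: "real^3" by (simp add: inner_axis)
    show "0 \<le> Q $ 3 \<and> Q $ 3 \<le> \<zeta> k"
      if "Q \<in> {P k, P k + (b k + \<zeta> k *\<^sub>R e3), P k + b k, P k + f k}" for k Q
      using that \<zeta>[of k] unfolding z3
      by (auto simp: inner_add_left P3 b3 planar e33)
    show "(\<lambda>k. \<zeta> k / dist (P k) (P k + (b k + \<zeta> k *\<^sub>R e3))) \<longlonglongrightarrow> 0"
    proof (rule Lim_null_comparison[OF _ flat_b], intro always_eventually allI)
      fix k
      have "0 < b k \<bullet> b k" by (simp only: bb) simp
      then have "0 < norm (b k)" by simp
      then show "norm (\<zeta> k / dist (P k) (P k + (b k + \<zeta> k *\<^sub>R e3))) \<le> \<zeta> k / norm (b k)"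
        unfolding d1 using lens(1)[of k] \<zeta>[of k] by (simp add: frac_le)
    qed
  qed
  have ii: "\<not> (\<exists>\<alpha>>0. \<forall>k. \<forall>\<theta>\<in>angles (T k). \<theta> \<ge> \<alpha>)"
  proof (rule limit_0_not_bounded_below)
    show "dihedral_angle (P k + f k) (P k) (P k + b k) (P k + (b k + \<zeta> k *\<^sub>R e3)) \<in> angles (T (2 * k))" for k
      unfolding T_even by (rule dihedral_angle_in_angles[OF nz])
        (use triple_nonzero_distinct[OF nz[of k]] in auto)
    \<comment> \<open>seen from \<open>P k + f k\<close>, so that the apex is above the third base vertex\<close>
    have "(\<lambda>k. dihedral_angle (P k + f k) (P k + f k + - f k) (P k + f k + f (Suc k))
        (P k + f k + (0 *\<^sub>R (- f k) + 1 *\<^sub>R f (Suc k) + \<zeta> k *\<^sub>R e3))) \<longlonglongrightarrow> 0"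
      by (rule dihedral_angle_tendsto_0[OF area_nz flat]) simp
    then show "(\<lambda>k. dihedral_angle (P k + f k) (P k) (P k + b k) (P k + (b k + \<zeta> k *\<^sub>R e3))) \<longlonglongrightarrow> 0"
      by (simp add: b_def add.assoc)
  qed
  have iii: "\<not> (\<exists>\<alpha><pi. \<forall>k. \<forall>\<theta>\<in>angles (T k). \<theta> \<le> \<alpha>)"
  proof (rule limit_not_bounded_above)
    show "planar_angle (P k + m k) (P k) (P k + b k) \<in> angles (T (Suc (2 * k)))" for k
      unfolding T_odd by (rule planar_angle_in_angles[OF nz'])
        (use triple_nonzero_distinct[OF nz'[of k]] in auto)
    have "b k \<noteq> 0" for k using bb[of k] by auto
    then show "(\<lambda>k. planar_angle (P k + m k) (P k) (P k + b k)) \<longlonglongrightarrow> pi"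
      unfolding m_def by (intro planar_angle_tendsto_pi b3 flat_b)
  qed
  have ties: "\<exists>e1 e2. e1 \<noteq> e2 \<and> longest_edge (T (Suc (2 * k))) e1 \<and> longest_edge (T (Suc (2 * k))) e2" for k
  proof (intro exI conjI)
    note iff = longest_edge_hull_iff[OF nz'[of k] longest'[of k]]
    have d: "distinct [P k + b k, P k, P k + f k, P k + m k]"
      by (rule triple_nonzero_distinct[OF nz'])
    show "closed_segment (P k + b k) (P k) \<noteq> closed_segment (P k + f k) (P k)"
      using d by (auto simp: closed_segment_eq doubleton_eq_iff)
    show "longest_edge (T (Suc (2 * k))) (closed_segment (P k + b k) (P k))"
      unfolding T_odd iff by (rule bexI[of _ "P k + b k"], rule bexI[of _ "P k"]) simp_all
    show "longest_edge (T (Suc (2 * k))) (closed_segment (P k + f k) (P k))"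
      unfolding T_odd iff using lens'(3)[of k]
      by - (rule bexI[of _ "P k + f k"], rule bexI[of _ "P k"], simp_all add: dist_norm)
  qed
  show ?thesis using seq i ii iii ties by blast
qed

section \<open>Failure of shape regularity and of both angle conditions\<close>

text \<open>For \<open>n = 2\<close> the ties occur at every odd step.\<close>

theorem theorem1:
  fixes n :: nat
  assumes "n \<ge> 2"
  shows "\<exists>(T :: nat \<Rightarrow> (real^3) set) (e :: nat \<Rightarrow> (real^3) set).
     (\<forall>k. tetrahedron (T k)) \<and>
     (\<forall>k. T (Suc k) \<subset> T k) \<and>
     (\<forall>k. longest_edge (T k) (e k) \<and> T (Suc k) \<in> children n (T k) (e k)) \<and>
     \<not> (\<exists>C::real. \<forall>k. diameter (T k) / inradius (T k) \<le> C) \<and>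
     \<not> (\<exists>\<alpha>\<^sub>0::real. \<alpha>\<^sub>0 > 0 \<and> (\<forall>k. \<forall>\<theta>\<in>angles (T k). \<theta> \<ge> \<alpha>\<^sub>0)) \<and>
     \<not> (\<exists>\<alpha>\<^sub>1::real. \<alpha>\<^sub>1 < pi \<and> (\<forall>k. \<forall>\<theta>\<in>angles (T k). \<theta> \<le> \<alpha>\<^sub>1)) \<and>
     (n \<ge> 3 \<longrightarrow> (\<forall>k. \<forall>e'. longest_edge (T k) e' \<longrightarrow> e' = e k)) \<and>
     (n = 2 \<longrightarrow> infinite {k. \<exists>e1 e2. e1 \<noteq> e2 \<and>
        longest_edge (T k) e1 \<and> longest_edge (T k) e2})"
proof (cases "n = 2")
  case True
  obtain T :: "nat \<Rightarrow> (real^3) set" and e :: "nat \<Rightarrow> (real^3) set" where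
    seq: "\<forall>k. tetrahedron (T k) \<and> T (Suc k) \<subset> T k \<and> longest_edge (T k) (e k) \<and>
       T (Suc k) \<in> children 2 (T k) (e k)"
    and fail: "\<not> (\<exists>C. \<forall>k. diameter (T k) / inradius (T k) \<le> C)"
     "\<not> (\<exists>\<alpha>>0. \<forall>k. \<forall>\<theta>\<in>angles (T k). \<theta> \<ge> \<alpha>)"
     "\<not> (\<exists>\<alpha><pi. \<forall>k. \<forall>\<theta>\<in>angles (T k). \<theta> \<le> \<alpha>)"
    and ties: "\<forall>k. \<exists>e1 e2. e1 \<noteq> e2 \<and> longest_edge (T (Suc (2 * k))) e1 \<and> longest_edge (T (Suc (2 * k))) e2"
    using flattening_bisection_sequence by (elim exE conjE) (rule that)
  have "infinite (range (\<lambda>k::nat. Suc (2 * k)))"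
    by (rule range_inj_infinite) (simp add: inj_def)
  moreover have "range (\<lambda>k. Suc (2 * k)) \<subseteq>
      {k. \<exists>e1 e2. e1 \<noteq> e2 \<and> longest_edge (T k) e1 \<and> longest_edge (T k) e2}"
    using ties by blast
  ultimately have inf: "infinite {k. \<exists>e1 e2. e1 \<noteq> e2 \<and> longest_edge (T k) e1 \<and> longest_edge (T k) e2}"
    by (rule infinite_super[rotated])
  show ?thesis
    by (rule exI[of _ T], rule exI[of _ e]) (use seq fail inf True in simp)
next
  case False
  then have "3 \<le> n" using assms by simp
  from flattening_nsection_sequence[OF this]
  obtain T :: "nat \<Rightarrow> (real^3) set" and e :: "nat \<Rightarrow> (real^3) set" where
    seq: "\<forall>k. tetrahedron (T k) \<and> T (Suc k) \<subset> T k \<and> longest_edge (T k) (e k) \<and>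
       T (Suc k) \<in> children n (T k) (e k)"
    and fail: "\<not> (\<exists>C. \<forall>k. diameter (T k) / inradius (T k) \<le> C)"
     "\<not> (\<exists>\<alpha>>0. \<forall>k. \<forall>\<theta>\<in>angles (T k). \<theta> \<ge> \<alpha>)"
     "\<not> (\<exists>\<alpha><pi. \<forall>k. \<forall>\<theta>\<in>angles (T k). \<theta> \<le> \<alpha>)"
    and unique: "\<forall>k e'. longest_edge (T k) e' \<longrightarrow> e' = e k"
    by (elim exE conjE) (rule that)
  show ?thesis
    by (rule exI[of _ T], rule exI[of _ e]) (use seq fail unique False in simp)
qed

end
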